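(* If $D$ is an acyclic digraph, then $\omega_x\,\Xi_D$ is $p$-positive.
   Context: A digraph is a finite labelled directed graph without multiple edges, possibly with loops; acyclic means having no directed cycles (in particular no loops). A path-cycle cover of $D$ is a subset $S$ of the edges of $D$ such that the spanning subgraph with edge set $S$ is a vertex-disjoint union of directed paths and directed cycles (isolated vertices are directed paths with no edges). $\pi(S)$ and $\sigma(S)$ are the sets of vertex sets of the paths and cycles respectively. With $x,y$ two countably infinite sets of commuting indeterminates, $\tilde m_\lambda=(r_1!r_2!\cdots)m_\lambda$ ($r_i$ the number of parts of $\lambda$ equal to $i$), and set partitions in subscripts standing for the integer partition of their block sizes, the path-cycle symmetric function is $\Xi_D=\sum_S\tilde m_{\pi(S)}(x)\,p_{\sigma(S)}(y)$, the sum over all path-cycle covers $S$ of $D$; for acyclic $D$ it is a symmetric function in $x$ only. $\omega_x$ is the usual involution $\omega$ on symmetric functions (sending $e_\lambda$ to $h_\lambda$) applied in the $x$ variables. A symmetric function is $p$-positive if its expansion in the power sum basis $\{p_\lambda\}$ has nonnegative coefficients. *)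

theory Defs
  imports
    "HOL-Library.Poly_Mapping"
    "HOL-Library.Multiset"
    "HOL-Library.Disjoint_Sets"
    "Graph_Theory.Graph_Theory"
begin

section \<open>Formal power series in countably many indeterminates\<close>

text \<open>An exponent vector \<^term>\<open>a :: nat \<Rightarrow>\<^sub>0 nat\<close> stands for the monomial in which the
  \<open>i\<close>-th indeterminate has exponent \<^term>\<open>Poly_Mapping.lookup a i\<close>. Symmetric functions live in this ring, and
  the type \<open>rat mps mps\<close> serves as the ring of power series in two countable sets of indeterminates
  \<open>x\<close> and \<open>y\<close>: the outer type constructor carries the \<open>y\<close> monomials, and the coefficients are power
  series in \<open>x\<close>.\<close>

typedef 'a mps = "UNIV :: ((nat \<Rightarrow>\<^sub>0 nat) \<Rightarrow> 'a) set"
  morphisms mcoeff Abs_mps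
  by simp

lemma mcoeff_Abs_mps [simp]: "mcoeff (Abs_mps f) a = f a"
  by (simp add: Abs_mps_inverse)

lemma mps_eqI: "(\<And>a. mcoeff f a = mcoeff g a) \<Longrightarrow> f = g"
  by (simp add: mcoeff_inject[symmetric] fun_eq_iff)

definition splittings :: "(nat \<Rightarrow>\<^sub>0 nat) \<Rightarrow> ((nat \<Rightarrow>\<^sub>0 nat) \<times> (nat \<Rightarrow>\<^sub>0 nat)) set"
  where "splittings a = {(b, c). b + c = a}"

lemma finite_splittings [simp]: "finite (splittings a)"
proof -
  let ?B = "{b. \<exists>c. b + c = a}"
  have "inj_on (\<lambda>b. restrict (Poly_Mapping.lookup b) (Poly_Mapping.keys a)) ?B"
  proof (rule inj_onI)
    fix b b'
    assume b: "b \<in> ?B" "b' \<in> ?B"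
      and eq: "restrict (Poly_Mapping.lookup b) (Poly_Mapping.keys a) = restrict (Poly_Mapping.lookup b') (Poly_Mapping.keys a)"
    show "b = b'"
    proof (rule poly_mapping_eqI)
      fix k
      show "Poly_Mapping.lookup b k = Poly_Mapping.lookup b' k"
      proof (cases "k \<in> Poly_Mapping.keys a")
        case True
        then show ?thesis using eq by (metis restrict_apply')
      next
        case False
        then have "Poly_Mapping.lookup a k = 0" by (simp add: in_keys_iff)
        then have "Poly_Mapping.lookup d k = 0" if "d \<in> ?B" for d
          using that by (auto simp: lookup_add)
        then show ?thesis using b by simp
      qed
    qed
  qed
  moreover have "(\<lambda>b. restrict (Poly_Mapping.lookup b) (Poly_Mapping.keys a)) ` ?B \<subseteq> PiE (Poly_Mapping.keys a) (\<lambda>i. {..Poly_Mapping.lookup a i})"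
    by (auto simp: lookup_add)
  moreover have "finite (PiE (Poly_Mapping.keys a) (\<lambda>i. {..Poly_Mapping.lookup a i}))"
    by (intro finite_PiE) auto
  ultimately have fin: "finite ?B"
    by (rule inj_on_finite)
  have "splittings a \<subseteq> (\<lambda>b. (b, a - b)) ` ?B"
    by (auto simp: splittings_def image_iff)
  then show ?thesis
    using fin by (rule finite_subset[OF _ finite_imageI])
qed

instantiation mps :: (comm_ring_1) comm_ring_1
begin

definition "0 = Abs_mps (\<lambda>_. 0)"
definition "1 = Abs_mps (\<lambda>a. if a = 0 then 1 else 0)"
definition "f + g = Abs_mps (\<lambda>a. mcoeff f a + mcoeff g a)"
definition "- f = Abs_mps (\<lambda>a. - mcoeff f a)"
definition "f - g = Abs_mps (\<lambda>a. mcoeff f a - mcoeff g a)"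
definition "f * g = Abs_mps (\<lambda>a. \<Sum>(b, c)\<in>splittings a. mcoeff f b * mcoeff g c)"

instance
proof
  fix f g h :: "'a mps"
  show "f + g + h = f + (g + h)" "f + g = g + f" "0 + f = f" "- f + f = 0" "f - g = f + - g"
    by (rule mps_eqI;
        simp add: zero_mps_def plus_mps_def uminus_mps_def minus_mps_def algebra_simps)+
  show "(0 :: 'a mps) \<noteq> 1"
  proof
    assume "(0 :: 'a mps) = 1"
    then have "mcoeff (0 :: 'a mps) 0 = mcoeff 1 0" by simp
    then show False by (simp add: zero_mps_def one_mps_def)
  qed
  show "(f + g) * h = f * h + g * h"
    by (rule mps_eqI)
      (simp add: plus_mps_def times_mps_def distrib_right sum.distrib case_prod_unfold)
  show "f * g = g * f"
  proof (rule mps_eqI)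
    fix a
    have "(\<Sum>(b, c)\<in>splittings a. mcoeff f b * mcoeff g c)
        = (\<Sum>(b, c)\<in>splittings a. mcoeff g b * mcoeff f c)"
      by (rule sum.reindex_bij_witness[of _ prod.swap prod.swap])
        (auto simp: splittings_def ac_simps)
    then show "mcoeff (f * g) a = mcoeff (g * f) a"
      by (simp add: times_mps_def)
  qed
  show "1 * f = f"
  proof (rule mps_eqI)
    fix a
    have "(\<Sum>(b, c)\<in>splittings a. (if b = 0 then 1 else 0) * mcoeff f c)
        = (\<Sum>(b, c)\<in>{(0 :: nat \<Rightarrow>\<^sub>0 nat, a)}. (if b = 0 then 1 else 0) * mcoeff f c)"
      by (rule sum.mono_neutral_right, simp)
        (auto simp: splittings_def split: if_splits)
    then show "mcoeff (1 * f) a = mcoeff f a"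
      by (simp add: times_mps_def one_mps_def)
  qed
  show "f * g * h = f * (g * h)"
  proof (rule mps_eqI)
    fix a
    have "mcoeff (f * g * h) a
        = (\<Sum>(d, c)\<in>splittings a. \<Sum>(b, b')\<in>splittings d. mcoeff f b * mcoeff g b' * mcoeff h c)"
      by (simp add: times_mps_def sum_distrib_right case_prod_unfold)
    also have "\<dots> = (\<Sum>((d, c), (b, b'))\<in>Sigma (splittings a) (\<lambda>(d, c). splittings d).
        mcoeff f b * mcoeff g b' * mcoeff h c)"
      by (subst sum.Sigma[symmetric]) (auto simp: case_prod_unfold)
    also have "\<dots> = (\<Sum>((b, d), (b', c))\<in>Sigma (splittings a) (\<lambda>(b, d). splittings d).
        mcoeff f b * mcoeff g b' * mcoeff h c)"
      by (rule sum.reindex_bij_witness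
          [of _ "\<lambda>((b, d), (b', c)). ((b + b', c), (b, b'))"
                "\<lambda>((d, c), (b, b')). ((b, b' + c), (b', c))"])
        (auto simp: splittings_def add.assoc)
    also have "\<dots> = (\<Sum>(b, d)\<in>splittings a. \<Sum>(b', c)\<in>splittings d. mcoeff f b * mcoeff g b' * mcoeff h c)"
      by (subst sum.Sigma[symmetric]) (auto simp: case_prod_unfold)
    also have "\<dots> = mcoeff (f * (g * h)) a"
      by (simp add: times_mps_def sum_distrib_left case_prod_unfold mult.assoc)
    finally show "mcoeff (f * g * h) a = mcoeff (f * (g * h)) a" .
  qed
qed

end

definition const_mps :: "'a::comm_ring_1 \<Rightarrow> 'a mps"
  where "const_mps r = Abs_mps (\<lambda>a. if a = 0 then r else 0)"

definition map_mps :: "('a \<Rightarrow> 'b) \<Rightarrow> 'a mps \<Rightarrow> 'b mps"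
  where "map_mps \<phi> f = Abs_mps (\<lambda>a. \<phi> (mcoeff f a))"


section \<open>Symmetric functions\<close>

text \<open>Integer partitions are multisets of positive natural numbers.\<close>

definition int_partitions :: "nat multiset set"
  where "int_partitions = {l. 0 \<notin># l}"

definition monomial_sym :: "nat multiset \<Rightarrow> 'a::comm_ring_1 mps"
  where "monomial_sym l =
    Abs_mps (\<lambda>a. if image_mset (Poly_Mapping.lookup a) (mset_set (Poly_Mapping.keys a)) = l then 1 else 0)"

definition aug_monomial_sym :: "nat multiset \<Rightarrow> 'a::comm_ring_1 mps"
  where "aug_monomial_sym l = of_nat (\<Prod>i\<in>set_mset l. fact (count l i)) * monomial_sym l"

definition power_sum_sym :: "nat multiset \<Rightarrow> 'a::comm_ring_1 mps"
  where "power_sum_sym l = (\<Prod>k\<in>#l. monomial_sym {#k#})"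

definition elementary_sym :: "nat multiset \<Rightarrow> 'a::comm_ring_1 mps"
  where "elementary_sym l = (\<Prod>k\<in>#l. monomial_sym (replicate_mset k 1))"

text \<open>The single-index \<open>h\<^sub>k\<close> is the sum of all monomials of total degree \<open>k\<close>.\<close>

definition complete_sym :: "nat multiset \<Rightarrow> 'a::comm_ring_1 mps"
  where "complete_sym l =
    (\<Prod>k\<in>#l. Abs_mps (\<lambda>a. if (\<Sum>i\<in>Poly_Mapping.keys a. Poly_Mapping.lookup a i) = k then 1 else 0))"

definition partition_comb ::
    "(nat multiset \<Rightarrow> 'a mps) \<Rightarrow> (nat multiset \<Rightarrow>\<^sub>0 'a) \<Rightarrow> 'a::comm_ring_1 mps"
  where "partition_comb b c = (\<Sum>l\<in>Poly_Mapping.keys c. const_mps (Poly_Mapping.lookup c l) * b l)"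

text \<open>The involution is the linear map with \<open>e\<^sub>\<lambda> \<mapsto> h\<^sub>\<lambda>\<close>. Since the \<open>e\<^sub>\<lambda>\<close> are a basis
  of the symmetric functions, the expansion \<^term>\<open>c\<close>, and hence the value, is unique for
  every symmetric function \<^term>\<open>f\<close>; on other power series the value is unspecified.\<close>

definition omega :: "'a::comm_ring_1 mps \<Rightarrow> 'a mps"
  where "omega f = (THE g. \<exists>c. Poly_Mapping.keys c \<subseteq> int_partitions \<and>
    f = partition_comb elementary_sym c \<and> g = partition_comb complete_sym c)"

text \<open>The involution in the \<open>x\<close> variables fixes the \<open>y\<close> monomials, that is, it acts on the
  coefficients of the outer power series.\<close>

definition omega_x :: "'a::comm_ring_1 mps mps \<Rightarrow> 'a mps mps"
  where "omega_x = map_mps omega"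

definition p_positive :: "'a::linordered_field mps \<Rightarrow> bool"
  where "p_positive f \<longleftrightarrow> (\<exists>c. Poly_Mapping.keys c \<subseteq> int_partitions \<and> (\<forall>l. 0 \<le> Poly_Mapping.lookup c l) \<and>
    f = partition_comb power_sum_sym c)"


section \<open>Path-cycle covers and the path-cycle symmetric function\<close>

definition is_dipath :: "'v pair_pre_digraph \<Rightarrow> bool"
  where "is_dipath H \<longleftrightarrow> (\<exists>u p v. pre_digraph.apath (with_proj H) u p v \<and>
    pverts H = set (pre_digraph.awalk_verts (with_proj H) u p) \<and> parcs H = set p)"

definition is_dicycle :: "'v pair_pre_digraph \<Rightarrow> bool"
  where "is_dicycle H \<longleftrightarrow> (\<exists>p. pre_digraph.cycle (with_proj H) p \<and>
    pverts H = fst ` set p \<and> parcs H = set p)"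

text \<open>The digraph with vertex set \<open>V\<close> and edge set \<open>S\<close> is the vertex-disjoint union of the
  paths in \<open>P\<close> and the cycles in \<open>C\<close>. Both families are determined by \<open>V\<close> and \<open>S\<close>.\<close>

definition path_cycle_decomp ::
    "'v set \<Rightarrow> 'v rel \<Rightarrow> 'v pair_pre_digraph set \<Rightarrow> 'v pair_pre_digraph set \<Rightarrow> bool"
  where "path_cycle_decomp V S P C \<longleftrightarrow>
    (\<forall>H\<in>P. is_dipath H) \<and> (\<forall>H\<in>C. is_dicycle H) \<and>
    disjoint_family_on pverts (P \<union> C) \<and>
    V = (\<Union>H\<in>P \<union> C. pverts H) \<and> S = (\<Union>H\<in>P \<union> C. parcs H)"

definition path_cycle_covers :: "'v pair_pre_digraph \<Rightarrow> 'v rel set"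
  where "path_cycle_covers D =
    {S. S \<subseteq> parcs D \<and> (\<exists>P C. path_cycle_decomp (pverts D) S P C)}"

definition path_blocks :: "'v pair_pre_digraph \<Rightarrow> 'v rel \<Rightarrow> 'v set set"
  where "path_blocks D S = {U. \<exists>P C. path_cycle_decomp (pverts D) S P C \<and> U \<in> pverts ` P}"

definition cycle_blocks :: "'v pair_pre_digraph \<Rightarrow> 'v rel \<Rightarrow> 'v set set"
  where "cycle_blocks D S = {U. \<exists>P C. path_cycle_decomp (pverts D) S P C \<and> U \<in> pverts ` C}"

definition block_sizes :: "'v set set \<Rightarrow> nat multiset"
  where "block_sizes \<pi> = image_mset card (mset_set \<pi>)"

definition path_cycle_sym :: "'v pair_pre_digraph \<Rightarrow> rat mps mps"
  where "path_cycle_sym D = (\<Sum>S\<in>path_cycle_covers D.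
    const_mps (aug_monomial_sym (block_sizes (path_blocks D S))) *
    power_sum_sym (block_sizes (cycle_blocks D S)))"

end

theory Submission
  imports Defs "HOL-Combinatorics.Permutations"
begin

text \<open>Let the acyclic digraph \<open>D\<close> have vertex set \<open>V\<close> and edge set \<open>E\<close>. The theorem holds because
  there is an explicit formula,
  \<open>\<omega> \<Xi>\<^sub>D = \<Sum>\<^sub>\<sigma> p\<^bsub>type(\<sigma>)\<^esub>\<close>, summed over the permutations \<open>\<sigma>\<close> of \<open>V\<close> such that no pair
  \<open>(v, \<sigma> v)\<close> is an edge of \<open>D\<close>; here \<open>type(\<sigma>)\<close> is the cycle type.
  As \<open>\<omega> p\<^sub>n = (-1)\<^sup>n\<^sup>-\<^sup>1 p\<^sub>n\<close>, the involution multiplies \<open>p\<^bsub>type(\<sigma>)\<^esub>\<close> by \<open>sign \<sigma>\<close>, so the formula amounts to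
  \<open>\<Xi>\<^sub>D = \<Sum>\<^sub>\<sigma> sign \<sigma> p\<^bsub>type(\<sigma>)\<^esub>\<close> over the same permutations
  (lemma \<open>path_covers_power_sum_expansion\<close>).

  The signed formula is proved one colouring \<open>f : V \<rightarrow> nat\<close> at a time. The coefficient of a monomial
  in an augmented monomial function of a set partition counts the colourings whose colour classes
  are exactly the blocks, and its coefficient in \<open>p\<^bsub>type(\<sigma>)\<^esub>\<close> counts the colourings with \<open>f \<circ> \<sigma> = f\<close>.
  So for each \<open>f\<close>, the number of path covers \<open>S\<close> whose paths are the colour
  classes of \<open>f\<close> has to equal the sum of \<open>sign \<sigma>\<close> over all \<open>\<sigma>\<close> that preserve \<open>f\<close> and avoid \<open>E\<close>
  (lemma \<open>card_covers_with_kernel\<close>). Inclusion-exclusion over the edges used by \<open>\<sigma>\<close> turns that sum into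
  \<open>\<Sum>\<^sub>S (-1)\<^bsup>|S|\<^esup> \<Sum>\<^sub>\<sigma> sign \<sigma>\<close>, where \<open>S\<close> ranges over the subsets of \<open>E\<close> and \<open>\<sigma>\<close> over the colour-preserving
  extensions of \<open>S\<close> to a permutation. If two sinks of \<open>S\<close>, that is, vertices with no outgoing edge
  in \<open>S\<close>, have the same colour, then composing \<open>\<sigma>\<close> with the transposition of these sinks is a
  sign-reversing involution and the inner sum vanishes. Otherwise there is at most one \<open>\<sigma>\<close>. It exists iff
  the components of \<open>S\<close> are paths that form the colour classes of \<open>f\<close>; then \<open>\<sigma>\<close> closes every path to
  a cycle, and its sign \<open>(-1)\<^bsup>|S|\<^esup>\<close> cancels the one in front. Acyclicity of \<open>D\<close> enters here: it
  makes every partial injection inside \<open>E\<close> a union of paths.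

  The involution is specified through expansions in the \<open>e\<^sub>\<lambda>\<close>, so evaluating it needs the uniqueness
  of such expansions. It follows from the leading monomials of the \<open>e\<^sub>\<lambda>\<close> in the lexicographic order,
  which are pairwise distinct (lemma \<open>elementary_sym_independent\<close>). The values \<open>\<omega> p\<^sub>n\<close> come from
  comparing Newton's identities for \<open>e\<^sub>n\<close> and for \<open>h\<^sub>n\<close>.\<close>

section \<open>Coefficients of power series\<close>

lemma mcoeff_simps [simp]:
  "mcoeff 0 a = 0" "mcoeff (f + g) a = mcoeff f a + mcoeff g a"
  "mcoeff (- f) a = - mcoeff f a" "mcoeff (f - g) a = mcoeff f a - mcoeff g a"
  by (simp_all add: zero_mps_def plus_mps_def uminus_mps_def minus_mps_def)

lemma mcoeff_one: "mcoeff 1 a = (if a = 0 then 1 else 0)"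
  by (simp add: one_mps_def)

lemma mcoeff_sum [simp]: "mcoeff (sum f A) a = (\<Sum>x\<in>A. mcoeff (f x) a)"
  by (induction A rule: infinite_finite_induct) auto

lemma mcoeff_times: "mcoeff (f * g) a = (\<Sum>(b, c)\<in>splittings a. mcoeff f b * mcoeff g c)"
  by (simp add: times_mps_def)

lemma mcoeff_const_mult [simp]: "mcoeff (const_mps r * f) a = r * mcoeff f a"
proof -
  have "mcoeff (const_mps r * f) a = (\<Sum>(b, c)\<in>{(0, a)}. mcoeff (const_mps r) b * mcoeff f c)"
    unfolding mcoeff_times
    by (rule sum.mono_neutral_right, simp) (auto simp: splittings_def const_mps_def split: if_splits)
  then show ?thesis by (simp add: const_mps_def)
qed

lemma mcoeff_of_nat_mult [simp]: "mcoeff (of_nat n * f) a = of_nat n * mcoeff f a"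
  by (induction n) (auto simp: algebra_simps)

lemma mcoeff_const: "mcoeff (const_mps r) a = (if a = 0 then r else 0)"
  by (simp add: const_mps_def)

lemma const_mps_mult: "const_mps r * const_mps s = const_mps (r * s)"
  by (rule mps_eqI) (simp add: mcoeff_const)

lemma const_mps_1 [simp]: "const_mps 1 = 1"
  by (rule mps_eqI) (simp add: const_mps_def mcoeff_one)

lemma const_mps_of_nat_mult: "const_mps (of_nat n) * f = of_nat n * f" "const_mps (- 1) * f = - f"
  by (rule mps_eqI, simp)+

lemma const_mps_sum: "const_mps (sum f A) = (\<Sum>x\<in>A. const_mps (f x))"
  by (rule mps_eqI) (simp add: const_mps_def)

section \<open>Newton's identities\<close>

definition total_degree :: "(nat \<Rightarrow>\<^sub>0 nat) \<Rightarrow> nat"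
  where "total_degree a = (\<Sum>i\<in>Poly_Mapping.keys a. Poly_Mapping.lookup a i)"

text \<open>The partition whose monomial symmetric function contains the monomial \<open>a\<close>.\<close>

definition exponents :: "(nat \<Rightarrow>\<^sub>0 nat) \<Rightarrow> nat multiset"
  where "exponents a = image_mset (Poly_Mapping.lookup a) (mset_set (Poly_Mapping.keys a))"

lemma total_degree_add: "total_degree (a + b) = total_degree a + total_degree b"
proof -
  have *: "total_degree c = (\<Sum>i\<in>Poly_Mapping.keys a \<union> Poly_Mapping.keys b. Poly_Mapping.lookup c i)"
    if "Poly_Mapping.keys c \<subseteq> Poly_Mapping.keys a \<union> Poly_Mapping.keys b" for c
    unfolding total_degree_def using that by (intro sum.mono_neutral_left) (auto simp: in_keys_iff)
  show ?thesis
    by (simp add: * Poly_Mapping.keys_add lookup_add sum.distrib)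
qed

lemma total_degree_single [simp]: "total_degree (Poly_Mapping.single j k) = k"
  by (simp add: total_degree_def)

lemma lookup_le_total_degree: "Poly_Mapping.lookup a j \<le> total_degree a"
proof (cases "j \<in> Poly_Mapping.keys a")
  case True
  then show ?thesis unfolding total_degree_def by (intro member_le_sum) auto
qed (simp add: in_keys_iff)

lemma total_degree_eq_0_iff: "total_degree a = 0 \<longleftrightarrow> a = 0"
proof
  assume "total_degree a = 0"
  then show "a = 0"
    using lookup_le_total_degree[of a] by (intro poly_mapping_eqI) simp
qed (simp add: total_degree_def)

lemma exponents_eq_replicate_iff:
  "exponents a = replicate_mset k 1 \<longleftrightarrow> (\<forall>i. Poly_Mapping.lookup a i \<le> 1) \<and> total_degree a = k"
proof
  assume *: "exponents a = replicate_mset k 1"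
  have "Poly_Mapping.lookup a i \<le> 1" for i
  proof (cases "i \<in> Poly_Mapping.keys a")
    case True
    then have "Poly_Mapping.lookup a i \<in># exponents a"
      by (simp add: exponents_def)
    then show ?thesis using * by (auto split: if_splits)
  qed (simp add: in_keys_iff)
  moreover have "total_degree a = sum_mset (exponents a)"
    by (simp add: total_degree_def exponents_def sum_unfold_sum_mset)
  ultimately show "(\<forall>i. Poly_Mapping.lookup a i \<le> 1) \<and> total_degree a = k"
    using * by (simp)
next
  assume *: "(\<forall>i. Poly_Mapping.lookup a i \<le> 1) \<and> total_degree a = k"
  have 1: "Poly_Mapping.lookup a i = 1" if "i \<in> Poly_Mapping.keys a" for i
    using * that by (metis in_keys_iff le_antisym less_one not_le)
  then have "k = card (Poly_Mapping.keys a)"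
    using * by (simp add: total_degree_def)
  moreover have "exponents a = image_mset (\<lambda>_. 1) (mset_set (Poly_Mapping.keys a))"
    unfolding exponents_def using 1 by (intro image_mset_cong) auto
  ultimately show "exponents a = replicate_mset k 1"
    by (simp add: image_mset_const_eq)
qed

lemma exponents_eq_single_iff:
  assumes "k > 0"
  shows "exponents a = {#k#} \<longleftrightarrow> (\<exists>j. a = Poly_Mapping.single j k)"
proof
  assume *: "exponents a = {#k#}"
  then have "size (mset_set (Poly_Mapping.keys a)) = 1"
    by (metis exponents_def size_image_mset size_single)
  then obtain j where j: "Poly_Mapping.keys a = {j}"
    by (auto simp: card_1_singleton_iff)
  then have "Poly_Mapping.lookup a j = k"
    using * by (simp add: exponents_def)
  then have "a = Poly_Mapping.single j k"
    using j by (intro poly_mapping_eqI) (metis in_keys_iff lookup_single_eq lookup_single_not_eq singletonD)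
  then show "\<exists>j. a = Poly_Mapping.single j k" ..
next
  assume "\<exists>j. a = Poly_Mapping.single j k"
  then show "exponents a = {#k#}" using assms by (auto simp: exponents_def)
qed

lemma mcoeff_elementary_sym_single:
  "mcoeff (elementary_sym {#k#}) a =
    (if (\<forall>i. Poly_Mapping.lookup a i \<le> 1) \<and> total_degree a = k then 1 else 0)"
  by (simp add: elementary_sym_def monomial_sym_def exponents_eq_replicate_iff[unfolded One_nat_def] flip: exponents_def)

lemma mcoeff_complete_sym_single:
  "mcoeff (complete_sym {#k#}) a = (if total_degree a = k then 1 else 0)"
  by (simp add: complete_sym_def total_degree_def)

lemma mcoeff_power_sum_sym_single:
  "k > 0 \<Longrightarrow> mcoeff (power_sum_sym {#k#}) a = (if \<exists>j. a = Poly_Mapping.single j k then 1 else 0)"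
  by (simp add: power_sum_sym_def monomial_sym_def exponents_eq_single_iff flip: exponents_def)

lemma minus_single_add:
  fixes a :: "nat \<Rightarrow>\<^sub>0 nat"
  assumes "k \<le> Poly_Mapping.lookup a j"
  shows "(a - Poly_Mapping.single j k) + Poly_Mapping.single j k = a"
  using assms by (intro poly_mapping_eqI) (auto simp: lookup_add lookup_minus lookup_single when_def)

lemma total_degree_minus_single:
  assumes "k \<le> Poly_Mapping.lookup a j"
  shows "total_degree (a - Poly_Mapping.single j k) = total_degree a - k"
  using total_degree_add[of "a - Poly_Mapping.single j k" "Poly_Mapping.single j k"]
  by (simp add: minus_single_add[OF assms])

lemma single_eq_singleD: "Poly_Mapping.single i k = Poly_Mapping.single j k \<Longrightarrow> k \<noteq> 0 \<Longrightarrow> i = j"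
  by (metis lookup_single_eq lookup_single_not_eq)

text \<open>Multiplication by \<open>p\<^sub>k\<close> adds \<open>k\<close> to one exponent, so the coefficient of a product is a sum over
  the positions at which \<open>k\<close> can be removed again.\<close>

lemma mcoeff_mult_power_sum:
  assumes "k > 0"
  shows "mcoeff (f * power_sum_sym {#k#}) a =
    (\<Sum>j | k \<le> Poly_Mapping.lookup a j. mcoeff f (a - Poly_Mapping.single j k))"
proof -
  let ?J = "{j. k \<le> Poly_Mapping.lookup a j}"
  have "mcoeff (f * power_sum_sym {#k#}) a = (\<Sum>(b, c)\<in>(\<lambda>j. (a - Poly_Mapping.single j k, Poly_Mapping.single j k)) ` ?J.
      mcoeff f b * mcoeff (power_sum_sym {#k#}) c)"
    unfolding mcoeff_times
  proof (rule sum.mono_neutral_right)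
    show "(\<lambda>j. (a - Poly_Mapping.single j k, Poly_Mapping.single j k)) ` ?J \<subseteq> splittings a"
      by (auto simp: splittings_def minus_single_add)
    show "\<forall>i\<in>splittings a - (\<lambda>j. (a - Poly_Mapping.single j k, Poly_Mapping.single j k)) ` ?J.
       (case i of (b, c) \<Rightarrow> mcoeff f b * mcoeff (power_sum_sym {#k#} :: 'a mps) c) = 0"
    proof safe
      fix b c assume bc: "(b, c) \<in> splittings a"
        and notin: "(b, c) \<notin> (\<lambda>j. (a - Poly_Mapping.single j k, Poly_Mapping.single j k)) ` ?J"
      have "c \<noteq> Poly_Mapping.single j k" for j
      proof
        assume "c = Poly_Mapping.single j k"
        then have "a = b + Poly_Mapping.single j k" "c = Poly_Mapping.single j k"
          using bc by (auto simp: splittings_def)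
        then have "(b, c) = (a - Poly_Mapping.single j k, Poly_Mapping.single j k)" "j \<in> ?J"
          by (auto simp: lookup_add)
        then show False using notin by blast
      qed
      then show "mcoeff f b * mcoeff (power_sum_sym {#k#} :: 'a mps) c = 0"
        using assms by (simp add: mcoeff_power_sum_sym_single)
    qed
  qed simp
  also have "\<dots> = (\<Sum>j\<in>?J. mcoeff f (a - Poly_Mapping.single j k))"
  proof (subst sum.reindex)
    have "mcoeff (power_sum_sym {#k#}) (Poly_Mapping.single j k) = (1 :: 'a)" for j
      using assms by (subst mcoeff_power_sum_sym_single) auto
    then show "sum ((\<lambda>(b, c). mcoeff f b * mcoeff (power_sum_sym {#k#}) c) \<circ>
        (\<lambda>j. (a - Poly_Mapping.single j k, Poly_Mapping.single j k))) ?J =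
        (\<Sum>j\<in>?J. mcoeff f (a - Poly_Mapping.single j k))"
      by simp
  qed (use assms in \<open>auto simp: inj_on_def dest: single_eq_singleD\<close>)
  finally show ?thesis .
qed

text \<open>The right-hand sides of both Newton identities at once. The families \<open>h\<^sub>k\<close> and \<open>e\<^sub>k\<close> are the
  degree-\<open>k\<close> sums of all monomials with a property \<open>Q\<close>, which is trivial for \<open>h\<close> and says
  square-free for \<open>e\<close>; the weights \<open>s i\<close> are \<open>1\<close> for \<open>h\<close> and the alternating signs for \<open>e\<close>.
  After exchanging the sums, only local sums over a single variable \<open>j\<close> remain.\<close>

lemma mcoeff_newton_sum:
  fixes g :: "nat \<Rightarrow> 'a::comm_ring_1 mps"
  assumes g: "\<And>k a. mcoeff (g k) a = (if Q a \<and> total_degree a = k then 1 else 0)"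
  shows "mcoeff (\<Sum>i=1..n. const_mps (s i) * (g (n - i) * power_sum_sym {#i#})) a =
    (if total_degree a = n then
       (\<Sum>j\<in>Poly_Mapping.keys a. \<Sum>i=1..Poly_Mapping.lookup a j. if Q (a - Poly_Mapping.single j i) then s i else 0)
     else 0)"
proof -
  have "mcoeff (\<Sum>i=1..n. const_mps (s i) * (g (n - i) * power_sum_sym {#i#})) a =
      (\<Sum>i=1..n. \<Sum>j | i \<le> Poly_Mapping.lookup a j. s i * mcoeff (g (n - i)) (a - Poly_Mapping.single j i))"
    by (simp add: mcoeff_mult_power_sum sum_distrib_left)
  also have "\<dots> = (\<Sum>i=1..n. \<Sum>j | j \<in> Poly_Mapping.keys a \<and> i \<le> Poly_Mapping.lookup a j.
      if total_degree a = n then (if Q (a - Poly_Mapping.single j i) then s i else 0) else 0)"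
  proof (intro sum.cong refl)
    fix i assume i: "i \<in> {1..n}"
    then show "{j. i \<le> Poly_Mapping.lookup a j} = {j. j \<in> Poly_Mapping.keys a \<and> i \<le> Poly_Mapping.lookup a j}"
      by (auto simp: in_keys_iff)
    fix j assume j: "j \<in> {j. j \<in> Poly_Mapping.keys a \<and> i \<le> Poly_Mapping.lookup a j}"
    then have "total_degree (a - Poly_Mapping.single j i) = n - i \<longleftrightarrow> total_degree a = n"
      using i lookup_le_total_degree[of a j] by (auto simp: total_degree_minus_single)
    then show "s i * mcoeff (g (n - i)) (a - Poly_Mapping.single j i) =
      (if total_degree a = n then (if Q (a - Poly_Mapping.single j i) then s i else 0) else 0)"
      by (simp add: g)
  qed
  also have "\<dots> = (if total_degree a = n then (\<Sum>i=1..n. \<Sum>j | j \<in> Poly_Mapping.keys a \<and> i \<le> Poly_Mapping.lookup a j.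
      if Q (a - Poly_Mapping.single j i) then s i else 0) else 0)"
    by simp
  also have "\<dots> = (if total_degree a = n then (\<Sum>j\<in>Poly_Mapping.keys a. \<Sum>i | i \<in> {1..n} \<and> i \<le> Poly_Mapping.lookup a j.
      if Q (a - Poly_Mapping.single j i) then s i else 0) else 0)"
    by (subst sum.swap_restrict) auto
  also have "\<dots> = (if total_degree a = n then
       (\<Sum>j\<in>Poly_Mapping.keys a. \<Sum>i=1..Poly_Mapping.lookup a j. if Q (a - Poly_Mapping.single j i) then s i else 0)
     else 0)"
  proof -
    have "{i. i \<in> {1..n} \<and> i \<le> Poly_Mapping.lookup a j} = {1..Poly_Mapping.lookup a j}" if "total_degree a = n" for j
      using that lookup_le_total_degree[of a j] by auto
    then show ?thesis by auto
  qed
  finally show ?thesis .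
qed

text \<open>Each variable \<open>j\<close> of a monomial contributes its exponent, and the exponents add up to the degree.\<close>

lemma newton_complete:
  "of_nat n * complete_sym {#n#} =
    (\<Sum>i=1..n. complete_sym {#n - i#} * power_sum_sym {#i#} :: 'a::comm_ring_1 mps)"
proof -
  have "of_nat n * complete_sym {#n#} =
    (\<Sum>i=1..n. const_mps 1 * (complete_sym {#n - i#} * power_sum_sym {#i#}) :: 'a mps)"
    by (rule mps_eqI, subst mcoeff_newton_sum[where Q = "\<lambda>_. True"])
      (auto simp: mcoeff_complete_sym_single total_degree_def)
  then show ?thesis by simp
qed

text \<open>Removing a power of a variable makes a monomial square-free either when it was square-free
  before, or when the variable was the only one with exponent at least \<open>2\<close>. In the second case
  exactly two consecutive powers can be removed, with opposite signs.\<close>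

lemma newton_elementary:
  "of_nat n * elementary_sym {#n#} =
    (\<Sum>i=1..n. const_mps ((-1) ^ (i - 1)) * (elementary_sym {#n - i#} * power_sum_sym {#i#}) :: 'a::comm_ring_1 mps)"
proof (rule mps_eqI)
  fix a :: "nat \<Rightarrow>\<^sub>0 nat"
  let ?Q = "\<lambda>a :: nat \<Rightarrow>\<^sub>0 nat. \<forall>i. Poly_Mapping.lookup a i \<le> 1"
  let ?s = "\<lambda>j i. if ?Q (a - Poly_Mapping.single j i) then (-1) ^ (i - 1) else (0::'a)"
  have minus: "?Q (a - Poly_Mapping.single j i) \<longleftrightarrow>
      Poly_Mapping.lookup a j \<le> Suc i \<and> (\<forall>k. k \<noteq> j \<longrightarrow> Poly_Mapping.lookup a k \<le> 1)" for i j
    by (auto simp: lookup_minus lookup_single when_def split: if_splits)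
  have inner: "(\<Sum>i=1..Poly_Mapping.lookup a j. ?s j i) = (if ?Q a then 1 else 0)"
    if j: "j \<in> Poly_Mapping.keys a" for j
  proof (cases "\<forall>k. k \<noteq> j \<longrightarrow> Poly_Mapping.lookup a k \<le> 1")
    case False
    then have "\<not> ?Q (a - Poly_Mapping.single j i)" for i unfolding minus by blast
    moreover have "\<not> ?Q a" using False by auto
    ultimately show ?thesis by (simp only: if_False sum.neutral_const)
  next
    case others: True
    have "Poly_Mapping.lookup a j \<noteq> 0" using j by (simp add: in_keys_iff)
    then consider "Poly_Mapping.lookup a j = 1" | m where "Poly_Mapping.lookup a j = Suc (Suc m)"
      by (metis One_nat_def not0_implies_Suc)
    then show ?thesis
    proof cases
      case 1
      have "?Q a"
      proof
        fix k show "Poly_Mapping.lookup a k \<le> 1" using others 1 by (cases "k = j") simp_all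
      qed
      moreover have "?Q (a - Poly_Mapping.single j 1)" unfolding minus using others 1 by simp
      ultimately show ?thesis using 1 by simp
    next
      case (2 m)
      \<comment> \<open>Only the removal of all but one or of all powers of \<open>j\<close> leaves a square-free monomial.\<close>
      then have neg: "\<not> ?Q a" by (metis One_nat_def Suc_le_mono not_less_eq_eq zero_le)
      have "(\<Sum>i=1..Poly_Mapping.lookup a j. ?s j i) = (\<Sum>i\<in>{Suc m, Suc (Suc m)}. ?s j i)"
        using 2 others unfolding minus by (intro sum.mono_neutral_right) auto
      also have "\<dots> = 0" using 2 others unfolding minus by auto
      finally show ?thesis using neg by simp
    qed
  qed
  have "(\<Sum>j\<in>Poly_Mapping.keys a. \<Sum>i=1..Poly_Mapping.lookup a j. ?s j i) = (if ?Q a then of_nat (total_degree a) else 0)"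
  proof (cases "?Q a")
    case True
    then have "total_degree a = (\<Sum>j\<in>Poly_Mapping.keys a. 1)"
      unfolding total_degree_def
      by (intro sum.cong refl) (metis in_keys_iff le_antisym less_one not_le)
    moreover have "(\<Sum>j\<in>Poly_Mapping.keys a. \<Sum>i=1..Poly_Mapping.lookup a j. ?s j i) = (\<Sum>j\<in>Poly_Mapping.keys a. 1)"
      using True by (intro sum.cong refl) (simp only: inner simp_thms if_True)
    ultimately show ?thesis using True by (simp only: of_nat_sum of_nat_1 simp_thms if_True)
  next
    case False
    then have "(\<Sum>j\<in>Poly_Mapping.keys a. \<Sum>i=1..Poly_Mapping.lookup a j. ?s j i) = (\<Sum>j\<in>Poly_Mapping.keys a. 0)"
      by (intro sum.cong refl) (simp only: inner if_False)
    then show ?thesis using False by (simp only: sum.neutral_const if_False)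
  qed
  then show "mcoeff (of_nat n * elementary_sym {#n#} :: 'a mps) a = mcoeff (\<Sum>i=1..n. const_mps ((-1) ^ (i - 1)) * (elementary_sym {#n - i#} * power_sum_sym {#i#})) a"
    by (subst mcoeff_newton_sum[where Q = ?Q]) (auto simp: mcoeff_elementary_sym_single)
qed

section \<open>Linear independence of the elementary symmetric functions\<close>

text \<open>The exponent vector of \<open>x\<^sub>0 x\<^sub>1 \<dots> x\<^sub>k\<^sub>-\<^sub>1\<close>, the lexicographically largest monomial of \<open>e\<^sub>k\<close>.\<close>

definition staircase :: "nat \<Rightarrow> nat \<Rightarrow>\<^sub>0 nat"
  where "staircase k = (\<Sum>i<k. Poly_Mapping.single i 1)"

lemma lookup_staircase: "Poly_Mapping.lookup (staircase k) i = (if i < k then 1 else 0)"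
  by (simp add: staircase_def lookup_sum lookup_single when_def)

lemma total_degree_staircase: "total_degree (staircase k) = k"
proof -
  have "Poly_Mapping.keys (staircase k) = {..<k}"
    by (auto simp: in_keys_iff lookup_staircase split: if_splits)
  then show ?thesis by (simp add: total_degree_def lookup_staircase)
qed

lemma mcoeff_elementary_leading:
  "mcoeff (elementary_sym {#k#}) (staircase k) = 1"
  by (simp add: mcoeff_elementary_sym_single total_degree_staircase lookup_staircase)

text \<open>The order on exponent vectors is lexicographic. A vector that first exceeds the staircase at
  position \<open>i\<close> agrees with it before, so its support contains the first \<open>k\<close> variables and one more,
  which is too much for degree \<open>k\<close>.\<close>

lemma mcoeff_elementary_le:
  assumes "mcoeff (elementary_sym {#k#} :: 'a::comm_ring_1 mps) a \<noteq> 0"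
  shows "a \<le> staircase k"
proof (rule ccontr)
  assume "\<not> a \<le> staircase k"
  then have "staircase k < a" by simp
  then obtain i where i: "Poly_Mapping.lookup (staircase k) i < Poly_Mapping.lookup a i"
      "\<And>i'. i' < i \<Longrightarrow> Poly_Mapping.lookup (staircase k) i' = Poly_Mapping.lookup a i'"
    by (auto simp: less_poly_mapping.rep_eq less_fun_def)
  have a: "Poly_Mapping.lookup a i \<le> 1" "total_degree a = k" for i
    using assms by (auto simp: mcoeff_elementary_sym_single split: if_splits)
  have "k \<le> i" using i(1) a(1)[of i] by (auto simp: lookup_staircase split: if_splits)
  then have "insert i {..<k} \<subseteq> Poly_Mapping.keys a"
    using i by (auto simp: in_keys_iff lookup_staircase split: if_splits) (metis (no_types) lookup_staircase less_le_trans neq0_conv zero_less_one)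
  then have "Suc k \<le> card (Poly_Mapping.keys a)"
    using \<open>k \<le> i\<close> card_mono[of "Poly_Mapping.keys a" "insert i {..<k}"] by simp
  moreover have "card (Poly_Mapping.keys a) \<le> total_degree a"
    unfolding total_degree_def card_eq_sum by (intro sum_mono) (simp add: in_keys_iff Suc_leI)
  ultimately show False using a(2) by simp
qed

text \<open>The exponent of the \<open>i\<close>-th variable is the number of parts greater than \<open>i\<close>; these exponents
  are the parts of the conjugate partition.\<close>

definition conjugate_monomial :: "nat multiset \<Rightarrow> nat \<Rightarrow>\<^sub>0 nat"
  where "conjugate_monomial l = (\<Sum>k\<in>#l. staircase k)"

lemma elementary_sym_add: "elementary_sym (l + m) = elementary_sym l * elementary_sym m"
  by (simp add: elementary_sym_def)

lemma complete_sym_add: "complete_sym (l + m) = complete_sym l * complete_sym m"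
  by (simp add: complete_sym_def)

lemma power_sum_sym_add: "power_sum_sym (l + m) = power_sum_sym l * power_sum_sym m"
  by (simp add: power_sum_sym_def)

text \<open>Leading monomials multiply, because the lexicographic order is compatible with addition.\<close>

lemma elementary_sym_leading:
  "(mcoeff (elementary_sym l :: 'a::comm_ring_1 mps) a \<noteq> 0 \<longrightarrow> a \<le> conjugate_monomial l) \<and>
   mcoeff (elementary_sym l :: 'a mps) (conjugate_monomial l) = 1"
proof (induction l arbitrary: a)
  case empty
  then show ?case by (auto simp: elementary_sym_def mcoeff_one conjugate_monomial_def)
next
  case (add k l)
  let ?f = "elementary_sym {#k#} :: 'a mps" and ?g = "elementary_sym l :: 'a mps"
  let ?u = "staircase k" and ?v = "conjugate_monomial l"
  have prod: "elementary_sym (add_mset k l) = ?f * ?g"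
    using elementary_sym_add[of "{#k#}" l] by simp
  have mon: "conjugate_monomial (add_mset k l) = ?u + ?v" by (simp add: conjugate_monomial_def)
  have le: "b \<le> ?u \<and> c \<le> ?v" if "mcoeff ?f b * mcoeff ?g c \<noteq> 0" for b c
  proof -
    have "mcoeff ?f b \<noteq> 0" "mcoeff ?g c \<noteq> 0" using that by auto
    then show ?thesis using add mcoeff_elementary_le[of k b, where ?'a = 'a] by blast
  qed
  have 1: "a \<le> ?u + ?v" if nz: "mcoeff (?f * ?g) a \<noteq> 0"
  proof -
    obtain b c where bc: "(b, c) \<in> splittings a" "mcoeff ?f b * mcoeff ?g c \<noteq> 0"
      using nz unfolding mcoeff_times by (auto elim!: sum.not_neutral_contains_not_neutral)
    have "b + c \<le> ?u + ?v" using le[OF bc(2)] by (intro add_mono) auto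
    then show ?thesis using bc(1) by (simp add: splittings_def)
  qed
  have "mcoeff (?f * ?g) (?u + ?v) = (\<Sum>(b, c)\<in>{(?u, ?v)}. mcoeff ?f b * mcoeff ?g c)"
    unfolding mcoeff_times
  proof (rule sum.mono_neutral_right)
    show "{(?u, ?v)} \<subseteq> splittings (?u + ?v)" by (simp add: splittings_def)
    have "b = ?u \<and> c = ?v" if "b + c = ?u + ?v" "mcoeff ?f b * mcoeff ?g c \<noteq> 0" for b c
      using le[OF that(2)] that(1)
      by (metis add_le_cancel_left add_le_cancel_right add_left_mono add_right_mono antisym)
    then show "\<forall>i\<in>splittings (?u + ?v) - {(?u, ?v)}. (case i of (b, c) \<Rightarrow> mcoeff ?f b * mcoeff ?g c) = 0"
      by (auto simp: splittings_def)
  qed simp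
  also have "\<dots> = 1" using add by (simp add: mcoeff_elementary_leading)
  finally show ?case using 1 by (simp add: prod mon)
qed

lemma lookup_conjugate_monomial:
  "Poly_Mapping.lookup (conjugate_monomial l) i = size (filter_mset (\<lambda>k. i < k) l)"
  by (induction l) (auto simp: conjugate_monomial_def lookup_add lookup_staircase)

text \<open>The number of parts equal to \<open>i + 1\<close> is the difference of two successive exponents.\<close>

lemma inj_on_conjugate_monomial: "inj_on conjugate_monomial int_partitions"
proof (rule inj_onI)
  fix l m assume lm: "l \<in> int_partitions" "m \<in> int_partitions"
    and eq: "conjugate_monomial l = conjugate_monomial m"
  have split: "size (filter_mset (\<lambda>k. i < k) l) = count l (Suc i) + size (filter_mset (\<lambda>k. Suc i < k) l)" for i l
  proof (induction l)
    case (add x l)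
    then show ?case by (cases "x = Suc i") auto
  qed simp
  show "l = m"
  proof (rule multiset_eqI)
    fix k
    show "count l k = count m k"
    proof (cases k)
      case 0
      then show ?thesis using lm by (simp add: int_partitions_def not_in_iff)
    next
      case (Suc i)
      then show ?thesis
        using split[of i l] split[of i m] eq lookup_conjugate_monomial
        by (metis add_right_cancel)
    qed
  qed
qed

lemma partition_comb_superset:
  assumes "finite A" "Poly_Mapping.keys c \<subseteq> A"
  shows "partition_comb b c = (\<Sum>l\<in>A. const_mps (Poly_Mapping.lookup c l) * b l)"
  unfolding partition_comb_def using assms
  by (intro sum.mono_neutral_left) (auto simp: in_keys_iff mps_eqI)

text \<open>Among the partitions on which two expansions differ, take the one with the largest leading
  monomial. No other such partition contributes to the coefficient of that monomial.\<close>

lemma elementary_sym_independent: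
  fixes c d :: "nat multiset \<Rightarrow>\<^sub>0 'a::comm_ring_1"
  assumes "Poly_Mapping.keys c \<subseteq> int_partitions" "Poly_Mapping.keys d \<subseteq> int_partitions"
    and eq: "partition_comb elementary_sym c = partition_comb elementary_sym d"
  shows "c = d"
proof (rule ccontr)
  assume "c \<noteq> d"
  let ?A = "Poly_Mapping.keys c \<union> Poly_Mapping.keys d"
  let ?K = "{l. Poly_Mapping.lookup c l \<noteq> Poly_Mapping.lookup d l}"
  let ?M = "Max (conjugate_monomial ` ?K)"
  have K: "?K \<subseteq> ?A" by (auto simp: in_keys_iff)
  then have fin: "finite ?K" by (rule finite_subset) simp
  have "?K \<noteq> {}" using \<open>c \<noteq> d\<close> by (auto simp: poly_mapping_eq_iff fun_eq_iff)
  then have "?M \<in> conjugate_monomial ` ?K" using fin by (intro Max_in) auto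
  then obtain l where "?M = conjugate_monomial l" "l \<in> ?K" by (rule imageE)
  then have l: "l \<in> ?K" "conjugate_monomial l = ?M" by simp_all
  have "0 = (\<Sum>m\<in>?A. (Poly_Mapping.lookup c m - Poly_Mapping.lookup d m) * mcoeff (elementary_sym m) ?M)"
  proof -
    have "(\<Sum>m\<in>?A. Poly_Mapping.lookup c m * mcoeff (elementary_sym m) ?M) = mcoeff (partition_comb elementary_sym c) ?M"
      by (subst partition_comb_superset[of ?A]) simp_all
    moreover have "(\<Sum>m\<in>?A. Poly_Mapping.lookup d m * mcoeff (elementary_sym m) ?M) = mcoeff (partition_comb elementary_sym d) ?M"
      by (subst partition_comb_superset[of ?A]) simp_all
    ultimately show ?thesis unfolding left_diff_distrib sum_subtractf eq by simp
  qed
  also have "\<dots> = (\<Sum>m\<in>{l}. (Poly_Mapping.lookup c m - Poly_Mapping.lookup d m) * mcoeff (elementary_sym m) ?M)"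
  proof (rule sum.mono_neutral_right)
    show "\<forall>m\<in>?A - {l}. (Poly_Mapping.lookup c m - Poly_Mapping.lookup d m) * mcoeff (elementary_sym m) ?M = 0"
    proof
      fix m assume "m \<in> ?A - {l}"
      then have m: "m \<in> ?A" "m \<noteq> l" by simp_all
      show "(Poly_Mapping.lookup c m - Poly_Mapping.lookup d m) * mcoeff (elementary_sym m) ?M = 0"
      proof (cases "m \<in> ?K")
        case True
        then have "conjugate_monomial m \<le> ?M" using fin by simp
        moreover have "conjugate_monomial m \<noteq> ?M"
          using inj_onD[OF inj_on_conjugate_monomial, of m l] l m assms K True by auto
        ultimately have "\<not> ?M \<le> conjugate_monomial m" by simp
        then show ?thesis using elementary_sym_leading[of m ?M, where ?'a = 'a] by auto
      qed simp
    qed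
  qed (use l K in auto)
  also have "\<dots> = Poly_Mapping.lookup c l - Poly_Mapping.lookup d l"
    using elementary_sym_leading[of l, where ?'a = 'a] l(2) by simp
  finally show False using l(1) by simp
qed

section \<open>The involution on power sums\<close>

text \<open>The graph of the involution, as a relation. It is closed under the ring operations by
  construction, before it is known to be single-valued.\<close>

definition omega_pair :: "'a::comm_ring_1 mps \<Rightarrow> 'a mps \<Rightarrow> bool"
  where "omega_pair f g \<longleftrightarrow> (\<exists>c. Poly_Mapping.keys c \<subseteq> int_partitions \<and>
    f = partition_comb elementary_sym c \<and> g = partition_comb complete_sym c)"

lemma omega_eqI: "omega_pair f g \<Longrightarrow> omega f = g"
  unfolding omega_def
proof (rule the_equality)
  fix g' assume "omega_pair f g" "\<exists>c. Poly_Mapping.keys c \<subseteq> int_partitions \<and>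
    f = partition_comb elementary_sym c \<and> g' = partition_comb complete_sym c"
  then show "g' = g" unfolding omega_pair_def using elementary_sym_independent by blast
qed (simp add: omega_pair_def)

lemma partition_comb_add: "partition_comb b (c + d) = partition_comb b c + partition_comb b d"
  using Poly_Mapping.keys_add[of c d]
  by (simp add: partition_comb_superset[of "Poly_Mapping.keys c \<union> Poly_Mapping.keys d"])
    (auto intro!: mps_eqI simp: lookup_add distrib_right sum.distrib)

lemma partition_comb_single: "partition_comb b (Poly_Mapping.single l r) = const_mps r * b l"
  by (subst partition_comb_superset[of "{l}"]) auto

lemma omega_pair_zero [simp]: "omega_pair 0 0"
  unfolding omega_pair_def by (rule exI[of _ 0]) (simp add: partition_comb_def)

lemma omega_pair_add: "omega_pair f g \<Longrightarrow> omega_pair f' g' \<Longrightarrow> omega_pair (f + f') (g + g')"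
  unfolding omega_pair_def
proof (elim exE conjE)
  fix c d assume "Poly_Mapping.keys c \<subseteq> int_partitions" "Poly_Mapping.keys d \<subseteq> int_partitions"
   "f = partition_comb elementary_sym c" "f' = partition_comb elementary_sym d"
   "g = partition_comb complete_sym c" "g' = partition_comb complete_sym d"
  then show "\<exists>c. Poly_Mapping.keys c \<subseteq> int_partitions \<and>
    f + f' = partition_comb elementary_sym c \<and> g + g' = partition_comb complete_sym c"
    using Poly_Mapping.keys_add[of c d] by (intro exI[of _ "c + d"]) (auto simp: partition_comb_add)
qed

lemma omega_pair_sum: "(\<And>x. x \<in> A \<Longrightarrow> omega_pair (f x) (g x)) \<Longrightarrow> omega_pair (sum f A) (sum g A)"
  by (induction A rule: infinite_finite_induct) (auto intro: omega_pair_add)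

lemma omega_pair_basis:
  assumes "l \<in> int_partitions"
  shows "omega_pair (const_mps r * elementary_sym l) (const_mps r * complete_sym l)"
  unfolding omega_pair_def using assms
  by (intro exI[of _ "Poly_Mapping.single l r"]) (auto simp: partition_comb_single)

lemma omega_pair_mult:
  assumes "omega_pair f g" "omega_pair f' g'"
  shows "omega_pair (f * f') (g * g')"
proof -
  obtain c d where c: "Poly_Mapping.keys c \<subseteq> int_partitions" "f = partition_comb elementary_sym c" "g = partition_comb complete_sym c"
    and d: "Poly_Mapping.keys d \<subseteq> int_partitions" "f' = partition_comb elementary_sym d" "g' = partition_comb complete_sym d"
    using assms unfolding omega_pair_def by blast
  have "omega_pair (\<Sum>l\<in>Poly_Mapping.keys c. \<Sum>m\<in>Poly_Mapping.keys d. const_mps (Poly_Mapping.lookup c l * Poly_Mapping.lookup d m) * elementary_sym (l + m))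
    (\<Sum>l\<in>Poly_Mapping.keys c. \<Sum>m\<in>Poly_Mapping.keys d. const_mps (Poly_Mapping.lookup c l * Poly_Mapping.lookup d m) * complete_sym (l + m))"
    using c(1) d(1) by (intro omega_pair_sum omega_pair_basis) (auto simp: int_partitions_def)
  then show ?thesis unfolding c d partition_comb_def sum_product elementary_sym_add complete_sym_add
    by (simp add: const_mps_mult[symmetric] mult_ac)
qed

lemma omega_pair_const: "omega_pair (const_mps r) (const_mps r)"
  using omega_pair_basis[of "{#}" r] by (simp add: int_partitions_def elementary_sym_def complete_sym_def)

lemma omega_pair_scale: "omega_pair f g \<Longrightarrow> omega_pair (const_mps r * f) (const_mps r * g)"
  by (intro omega_pair_mult omega_pair_const)

lemma generator_zero: "elementary_sym {#0#} = 1" "complete_sym {#0#} = 1"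
  by (rule mps_eqI, simp add: mcoeff_elementary_sym_single mcoeff_complete_sym_single
      mcoeff_one total_degree_eq_0_iff)+

lemma omega_pair_generator: "omega_pair (elementary_sym {#n#}) (complete_sym {#n#})"
proof (cases "n = 0")
  case True
  show ?thesis using omega_pair_const[of 1] True by (simp add: generator_zero)
next
  case False
  then show ?thesis using omega_pair_basis[of "{#n#}" 1] by (simp add: int_partitions_def)
qed

text \<open>Newton's identities express \<open>(-1)\<^sup>n\<^sup>-\<^sup>1 p\<^sub>n\<close> through the \<open>e\<^sub>i\<close> and the \<open>(-1)\<^sup>i\<^sup>-\<^sup>1 p\<^sub>i\<close> with \<open>i < n\<close> by
  the same formula that expresses \<open>p\<^sub>n\<close> through the \<open>h\<^sub>i\<close> and \<open>p\<^sub>i\<close>.\<close>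

lemma omega_pair_power_sum_single:
  assumes "n > 0"
  shows "omega_pair (const_mps ((-1) ^ (n - 1)) * power_sum_sym {#n#}) (power_sum_sym {#n#} :: 'a::comm_ring_1 mps)"
  using assms
proof (induction n rule: less_induct)
  case (less n)
  let ?e = "\<lambda>i. elementary_sym {#i#} :: 'a mps" and ?h = "\<lambda>i. complete_sym {#i#} :: 'a mps"
    and ?p = "\<lambda>i. power_sum_sym {#i#} :: 'a mps"
  have split: "{1..n} = insert n {1..<n}" using less.prems by auto
  have e: "const_mps ((-1) ^ (n - 1)) * ?p n =
      const_mps (of_nat n) * ?e n + const_mps (- 1) * (\<Sum>i=1..<n. ?e (n - i) * (const_mps ((-1) ^ (i - 1)) * ?p i))"
    using newton_elementary[of n, where ?'a = 'a] unfolding split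
    by (simp add: generator_zero const_mps_of_nat_mult mult_ac)
  have h: "?p n = const_mps (of_nat n) * ?h n + const_mps (- 1) * (\<Sum>i=1..<n. ?h (n - i) * ?p i)"
    using newton_complete[of n, where ?'a = 'a] unfolding split
    by (simp add: generator_zero const_mps_of_nat_mult mult_ac)
  show ?case
    unfolding e by (subst h)
      (intro omega_pair_add omega_pair_scale omega_pair_sum omega_pair_mult omega_pair_generator less.IH; simp)
qed

lemma omega_pair_power_sum:
  assumes "l \<in> int_partitions"
  shows "omega_pair (const_mps (of_int (\<Prod>k\<in>#l. (-1) ^ (k - 1))) * power_sum_sym l)
    (power_sum_sym l :: 'a::comm_ring_1 mps)"
  using assms
proof (induction l)
  case empty
  then show ?case using omega_pair_const[of "1 :: 'a"] by (simp add: power_sum_sym_def)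
next
  case (add k l)
  then have k: "k > 0" and l: "l \<in> int_partitions" by (auto simp: int_partitions_def)
  let ?c = "\<lambda>l. const_mps (of_int (\<Prod>k\<in>#l. (-1) ^ (k - 1))) :: 'a mps"
  have split: "power_sum_sym (add_mset k l) = (power_sum_sym {#k#} * power_sum_sym l :: 'a mps)"
    using power_sum_sym_add[of "{#k#}" l] by simp
  have "?c (add_mset k l) = const_mps ((-1) ^ (k - 1)) * ?c l"
    by (simp add: const_mps_mult)
  then have "?c (add_mset k l) * power_sum_sym (add_mset k l) =
      (const_mps ((-1) ^ (k - 1)) * power_sum_sym {#k#}) * (?c l * power_sum_sym l)"
    unfolding split by (simp add: mult_ac)
  then show ?case
    unfolding split by (simp only: omega_pair_mult omega_pair_power_sum_single[OF k] add.IH[OF l])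
qed

section \<open>Vertex colourings\<close>

text \<open>Colourings of weighted vertices whose colour \<open>i\<close> has total weight \<open>lookup a i\<close>. Weights
  other than \<open>1\<close> arise when vertices are merged into blocks. Functions are extensional, so that they
  can be counted.\<close>

definition colourings :: "'v set \<Rightarrow> ('v \<Rightarrow> nat) \<Rightarrow> (nat \<Rightarrow>\<^sub>0 nat) \<Rightarrow> ('v \<Rightarrow> nat) set"
  where "colourings V w a =
    {f \<in> V \<rightarrow>\<^sub>E UNIV. \<forall>i. (\<Sum>v\<in>V. if f v = i then w v else 0) = Poly_Mapping.lookup a i}"

lemma colourings_sum:
  "f \<in> colourings V w a \<Longrightarrow> (\<Sum>v\<in>V. if f v = i then w v else 0) = Poly_Mapping.lookup a i"
  by (simp add: colourings_def)

lemma finite_colourings: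
  assumes "finite V" "\<And>v. v \<in> V \<Longrightarrow> w v > 0"
  shows "finite (colourings V w a)"
proof (rule finite_subset)
  show "colourings V w a \<subseteq> V \<rightarrow>\<^sub>E Poly_Mapping.keys a"
  proof
    fix f assume f: "f \<in> colourings V w a"
    have "f v \<in> Poly_Mapping.keys a" if "v \<in> V" for v
    proof -
      have "w v \<le> (\<Sum>u\<in>V. if f u = f v then w u else 0)"
        using member_le_sum[of v V "\<lambda>u. if f u = f v then w u else 0"] assms(1) that by simp
      then show ?thesis using assms(2)[OF that] colourings_sum[OF f, of "f v"]
        by (simp add: in_keys_iff)
    qed
    then show "f \<in> V \<rightarrow>\<^sub>E Poly_Mapping.keys a"
      using f by (auto simp: colourings_def PiE_iff)
  qed
qed (use assms in \<open>auto intro: finite_PiE\<close>)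

text \<open>Classify by the colour \<open>j\<close> of the new vertex. This mirrors multiplication by \<open>p\<^bsub>w x\<^esub>\<close>, which is
  what the lemma is for; the predicate \<open>P\<close> allows for injective and for invariant colourings.\<close>

lemma card_colourings_insert:
  assumes V: "finite V" "x \<notin> V" and w: "w x > 0" "\<And>v. v \<in> V \<Longrightarrow> w v > 0"
  shows "card {f \<in> colourings (insert x V) w a. P f} =
    (\<Sum>j | w x \<le> Poly_Mapping.lookup a j.
      card {g \<in> colourings V w (a - Poly_Mapping.single j (w x)). P (g(x := j))})"
proof -
  let ?J = "{j. w x \<le> Poly_Mapping.lookup a j}"
  let ?G = "\<lambda>j. {g \<in> colourings V w (a - Poly_Mapping.single j (w x)). P (g(x := j))}"
  have "?J \<subseteq> Poly_Mapping.keys a" using w by (auto simp: in_keys_iff)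
  then have J: "finite ?J" by (rule finite_subset) simp
  have sum_V: "(\<Sum>v\<in>V. if (g(x := j)) v = i then w v else 0) = (\<Sum>v\<in>V. if g v = i then w v else 0)"
    for g :: "'a \<Rightarrow> nat" and i j using V by (intro sum.cong) auto
  have "bij_betw (\<lambda>(j, g). g(x := j)) (Sigma ?J ?G) {f \<in> colourings (insert x V) w a. P f}"
  proof (rule bij_betw_byWitness[where f' = "\<lambda>f. (f x, restrict f V)"])
    show "\<forall>p\<in>Sigma ?J ?G. (\<lambda>f. (f x, restrict f V)) ((\<lambda>(j, g). g(x := j)) p) = p"
    proof -
      have "restrict (g(x := j)) V = g" if "g \<in> colourings V w b" for g j b
        using that V by (auto simp: colourings_def fun_eq_iff restrict_def PiE_iff extensional_def)
      then show ?thesis by auto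
    qed
    show "\<forall>f\<in>{f \<in> colourings (insert x V) w a. P f}. (\<lambda>(j, g). g(x := j)) (f x, restrict f V) = f"
      by (auto simp: colourings_def PiE_iff extensional_def fun_eq_iff)
    show "(\<lambda>(j, g). g(x := j)) ` Sigma ?J ?G \<subseteq> {f \<in> colourings (insert x V) w a. P f}"
    proof (rule image_subsetI)
      fix p assume "p \<in> Sigma ?J ?G"
      then obtain j g where p: "p = (j, g)" and j: "w x \<le> Poly_Mapping.lookup a j"
        and g: "g \<in> colourings V w (a - Poly_Mapping.single j (w x))" and P: "P (g(x := j))"
        by auto
      have "g(x := j) \<in> colourings (insert x V) w a"
        unfolding colourings_def
      proof (intro CollectI conjI allI)
        show "g(x := j) \<in> insert x V \<rightarrow>\<^sub>E UNIV"
          using g by (auto simp: colourings_def PiE_iff extensional_def)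
        fix i
        show "(\<Sum>v\<in>insert x V. if (g(x := j)) v = i then w v else 0) = Poly_Mapping.lookup a i"
          using V j unfolding sum.insert[OF V] sum_V
          by (auto simp: colourings_sum[OF g] lookup_minus lookup_single)
      qed
      with P show "(\<lambda>(j, g). g(x := j)) p \<in> {f \<in> colourings (insert x V) w a. P f}" by (simp add: p)
    qed
    show "(\<lambda>f. (f x, restrict f V)) ` {f \<in> colourings (insert x V) w a. P f} \<subseteq> Sigma ?J ?G"
    proof (rule image_subsetI)
      fix f assume "f \<in> {f \<in> colourings (insert x V) w a. P f}"
      then have f: "f \<in> colourings (insert x V) w a" and P: "P f" by simp_all
      have sum: "Poly_Mapping.lookup a i = (if f x = i then w x else 0) + (\<Sum>v\<in>V. if f v = i then w v else 0)" for i
        using colourings_sum[OF f, of i] V by simp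
      have "(\<Sum>v\<in>V. if restrict f V v = i then w v else 0) = (\<Sum>v\<in>V. if f v = i then w v else 0)" for i
        by (intro sum.cong) auto
      then have restr: "restrict f V \<in> colourings V w (a - Poly_Mapping.single (f x) (w x))"
        using sum by (auto simp: colourings_def lookup_minus lookup_single when_def)
      have eq: "(restrict f V)(x := f x) = f"
        using f by (auto simp: colourings_def PiE_iff extensional_def fun_eq_iff)
      moreover have "P ((restrict f V)(x := f x))" by (subst eq) (rule P)
      moreover have "w x \<le> Poly_Mapping.lookup a (f x)" using sum[of "f x"] by simp
      ultimately show "(f x, restrict f V) \<in> Sigma ?J ?G"
        using restr by (intro SigmaI CollectI conjI)
    qed
  qed
  then have "card {f \<in> colourings (insert x V) w a. P f} = card (Sigma ?J ?G)"
    by (rule bij_betw_same_card[symmetric])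
  also have "\<dots> = (\<Sum>j\<in>?J. card (?G j))"
  proof (intro card_SigmaI J ballI)
    fix j
    have "finite (colourings V w (a - Poly_Mapping.single j (w x)))"
      using V w by (intro finite_colourings) auto
    then show "finite (?G j)" by simp
  qed
  finally show ?thesis .
qed

lemma colourings_empty: "colourings {} w a = (if a = 0 then {\<lambda>_. undefined} else {})"
  by (auto simp: colourings_def poly_mapping_eq_iff fun_eq_iff)

section \<open>Augmented monomial functions count injective colourings\<close>

lemma prod_fact_count_add_mset:
  "(\<Prod>i\<in>set_mset (add_mset k W). fact (count (add_mset k W) i)) =
    Suc (count W k) * (\<Prod>i\<in>set_mset W. fact (count W i))"
proof -
  have "(\<Prod>i\<in>set_mset (add_mset k W). fact (count (add_mset k W) i)) =
      fact (Suc (count W k)) * (\<Prod>i\<in>set_mset W - {k}. fact (count W i))"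
    by (simp add: prod.insert_remove del: fact_Suc) (intro arg_cong2[where f = "(*)"] prod.cong; auto)
  also have "\<dots> = Suc (count W k) * (fact (count W k) * (\<Prod>i\<in>set_mset W - {k}. fact (count W i)))"
    by (simp add: algebra_simps)
  also have "fact (count W k) * (\<Prod>i\<in>set_mset W - {k}. fact (count W i)) = (\<Prod>i\<in>set_mset W. fact (count W i))"
  proof (cases "k \<in># W")
    case True
    then show ?thesis by (simp add: prod.remove)
  next
    case False
    then have "count W k = 0" "set_mset W - {k} = set_mset W" by (auto simp: not_in_iff)
    then show ?thesis by simp
  qed
  finally show ?thesis .
qed

lemma exponents_minus_single:
  assumes "Poly_Mapping.lookup a j = k" "k > 0"
  shows "exponents a = add_mset k (exponents (a - Poly_Mapping.single j k))"
proof -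
  let ?b = "a - Poly_Mapping.single j k"
  have keys: "Poly_Mapping.keys a = insert j (Poly_Mapping.keys ?b)" "j \<notin> Poly_Mapping.keys ?b"
    using assms by (auto simp: in_keys_iff lookup_minus lookup_single when_def split: if_splits)
  have "image_mset (Poly_Mapping.lookup a) (mset_set (Poly_Mapping.keys ?b)) = exponents ?b"
    unfolding exponents_def using keys(2)
    by (intro image_mset_cong) (auto simp: lookup_minus lookup_single when_def)
  then show ?thesis using keys assms by (simp add: exponents_def)
qed

lemma count_exponents:
  "k > 0 \<Longrightarrow> count (exponents a) k = card {j. Poly_Mapping.lookup a j = k}"
proof -
  assume "k > 0"
  then have "Poly_Mapping.lookup a -` {k} \<inter> Poly_Mapping.keys a = {j. Poly_Mapping.lookup a j = k}"
    by (auto simp: in_keys_iff)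
  moreover have "sum (count (mset_set (Poly_Mapping.keys a))) {j. Poly_Mapping.lookup a j = k} = (\<Sum>j | Poly_Mapping.lookup a j = k. 1)"
    using \<open>k > 0\<close> by (intro sum.cong refl) (auto simp: in_keys_iff)
  ultimately show ?thesis by (simp add: exponents_def count_image_mset)
qed

text \<open>An injective colouring matches the vertices with the variables of the monomial so that weights
  equal exponents. Equal weights can be permuted freely, whence the factorials. In the induction,
  the new vertex must take a colour \<open>j\<close> whose exponent it exhausts; the number of such \<open>j\<close> is
  the multiplicity of its weight.\<close>

lemma card_injective_colourings:
  assumes "finite B" "\<And>x. x \<in> B \<Longrightarrow> w x > 0"
  shows "card {f \<in> colourings B w a. inj_on f B} =
    (if exponents a = image_mset w (mset_set B)
     then \<Prod>i\<in>w ` B. fact (count (image_mset w (mset_set B)) i) else 0)"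
  using assms
proof (induction B arbitrary: a rule: finite_induct)
  case empty
  have "exponents a = {#} \<longleftrightarrow> a = 0" by (auto simp: exponents_def mset_set_empty_iff)
  then show ?case by (auto simp: colourings_empty)
next
  case (insert x B)
  let ?k = "w x" and ?W = "image_mset w (mset_set B)"
  let ?F = "\<lambda>W. \<Prod>i\<in>set_mset W. fact (count W i) :: nat"
  have k: "?k > 0" using insert by simp
  have IH: "card {f \<in> colourings B w a. inj_on f B} = (if exponents a = ?W then ?F ?W else 0)" for a
    using insert by simp
  have "card {f \<in> colourings (insert x B) w a. inj_on f (insert x B)} =
      (\<Sum>j | ?k \<le> Poly_Mapping.lookup a j.
        card {g \<in> colourings B w (a - Poly_Mapping.single j ?k). inj_on (g(x := j)) (insert x B)})"
    using insert by (intro card_colourings_insert) auto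
  also have "\<dots> = (\<Sum>j | ?k \<le> Poly_Mapping.lookup a j.
      if Poly_Mapping.lookup a j = ?k then card {g \<in> colourings B w (a - Poly_Mapping.single j ?k). inj_on g B} else 0)"
  proof (intro sum.cong refl)
    fix j assume j: "j \<in> {j. ?k \<le> Poly_Mapping.lookup a j}"
    have inj: "inj_on (g(x := j)) (insert x B) \<longleftrightarrow> inj_on g B \<and> j \<notin> g ` B" for g
    proof -
      have "inj_on (g(x := j)) B \<longleftrightarrow> inj_on g B" using insert.hyps by (intro inj_on_cong) auto
      moreover have "(g(x := j)) ` B = g ` B" using insert.hyps by (auto simp: image_iff)
      ultimately show ?thesis using insert.hyps by auto
    qed
    \<comment> \<open>The weights are positive, so a colour is unused iff its remaining exponent is \<open>0\<close>.\<close>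
    have unused: "j \<notin> g ` B \<longleftrightarrow> Poly_Mapping.lookup a j = ?k"
      if g: "g \<in> colourings B w (a - Poly_Mapping.single j ?k)" for g
    proof -
      have "(\<Sum>v\<in>B. if g v = j then w v else 0) = Poly_Mapping.lookup a j - ?k"
        using colourings_sum[OF g, of j] by (simp add: lookup_minus)
      moreover have "(\<Sum>v\<in>B. if g v = j then w v else 0) = 0 \<longleftrightarrow> j \<notin> g ` B"
        using insert.hyps insert.prems by (fastforce split: if_splits)
      ultimately show ?thesis using j by auto
    qed
    show "card {g \<in> colourings B w (a - Poly_Mapping.single j ?k). inj_on (g(x := j)) (insert x B)} =
      (if Poly_Mapping.lookup a j = ?k then card {g \<in> colourings B w (a - Poly_Mapping.single j ?k). inj_on g B} else 0)"
    proof (cases "Poly_Mapping.lookup a j = ?k")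
      case True
      then have "{g \<in> colourings B w (a - Poly_Mapping.single j ?k). inj_on (g(x := j)) (insert x B)} =
          {g \<in> colourings B w (a - Poly_Mapping.single j ?k). inj_on g B}"
        using inj unused by blast
      then show ?thesis using True by simp
    next
      case False
      then have "{g \<in> colourings B w (a - Poly_Mapping.single j ?k). inj_on (g(x := j)) (insert x B)} = {}"
        using inj unused by blast
      then show ?thesis using False by (simp only: card.empty if_False)
    qed
  qed
  also have "\<dots> = (\<Sum>j | Poly_Mapping.lookup a j = ?k. card {g \<in> colourings B w (a - Poly_Mapping.single j ?k). inj_on g B})"
  proof (rule sum.mono_neutral_cong_right)
    have "{j. ?k \<le> Poly_Mapping.lookup a j} \<subseteq> Poly_Mapping.keys a" using k by (auto simp: in_keys_iff)
    then show "finite {j. ?k \<le> Poly_Mapping.lookup a j}" by (rule finite_subset) simp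
  qed auto
  also have "\<dots> = (\<Sum>j | Poly_Mapping.lookup a j = ?k. if exponents a = add_mset ?k ?W then ?F ?W else 0)"
    using k by (intro sum.cong refl) (simp add: IH exponents_minus_single)
  also have "\<dots> = (if exponents a = add_mset ?k ?W then count (exponents a) ?k * ?F ?W else 0)"
    using k by (simp add: count_exponents[OF k, symmetric])
  also have "\<dots> = (if exponents a = add_mset ?k ?W then ?F (add_mset ?k ?W) else 0)"
    unfolding prod_fact_count_add_mset by simp
  finally show ?case using insert.hyps by simp
qed

text \<open>The factorials in the augmented monomial function are precisely those that make its
  coefficients counts of injective colourings.\<close>

lemma mcoeff_aug_monomial_sym:
  assumes "finite B" "\<And>x. x \<in> B \<Longrightarrow> w x > 0"
  shows "mcoeff (aug_monomial_sym (image_mset w (mset_set B))) a =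
    of_nat (card {f \<in> colourings B w a. inj_on f B})"
  using assms unfolding aug_monomial_sym_def mcoeff_of_nat_mult
  by (simp add: card_injective_colourings monomial_sym_def flip: exponents_def)

text \<open>A colouring with these colour classes factors as \<open>g \<circ> \<kappa>\<close> for a unique \<open>g\<close>.\<close>

lemma card_colourings_with_kernel:
  assumes "finite V"
  shows "card {f \<in> colourings V (\<lambda>_. 1) a. \<forall>u\<in>V. \<forall>v\<in>V. f u = f v \<longleftrightarrow> \<kappa> u = \<kappa> v} =
    card {g \<in> colourings (\<kappa> ` V) (\<lambda>B. card {v \<in> V. \<kappa> v = B}) a. inj_on g (\<kappa> ` V)}"
    (is "card ?F = card ?G")
proof -
  have sums: "(\<Sum>v\<in>V. if g (\<kappa> v) = i then 1 else 0) =
      (\<Sum>B\<in>\<kappa> ` V. if g B = i then card {v \<in> V. \<kappa> v = B} else 0)" for g :: "'b \<Rightarrow> nat" and i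
  proof -
    have "(\<Sum>v\<in>V. if g (\<kappa> v) = i then 1 else 0) = (\<Sum>B\<in>\<kappa> ` V. \<Sum>v\<in>{v \<in> V. \<kappa> v = B}. if g (\<kappa> v) = i then 1 else 0)"
      using assms by (intro sum.group[symmetric]) auto
    also have "\<dots> = (\<Sum>B\<in>\<kappa> ` V. \<Sum>v\<in>{v \<in> V. \<kappa> v = B}. if g B = i then 1 else 0)"
      by (intro sum.cong) auto
    also have "\<dots> = (\<Sum>B\<in>\<kappa> ` V. if g B = i then card {v \<in> V. \<kappa> v = B} else 0)"
      by (intro sum.cong) auto
    finally show ?thesis .
  qed
  let ?s = "inv_into V \<kappa>"
  have s: "?s B \<in> V" "\<kappa> (?s B) = B" if "B \<in> \<kappa> ` V" for B
    using that by (auto intro: inv_into_into f_inv_into_f)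
  have "bij_betw (\<lambda>g. restrict (g \<circ> \<kappa>) V) ?G ?F"
  proof (rule bij_betw_byWitness[where f' = "\<lambda>f. restrict (f \<circ> ?s) (\<kappa> ` V)"])
    show "\<forall>g\<in>?G. restrict (restrict (g \<circ> \<kappa>) V \<circ> ?s) (\<kappa> ` V) = g"
      using s by (auto simp: colourings_def PiE_iff extensional_def fun_eq_iff restrict_def)
    have class_rep: "f (?s (\<kappa> v)) = f v" if "f \<in> ?F" "v \<in> V" for f v
      using that s[of "\<kappa> v"] by auto
    show "\<forall>f\<in>?F. restrict (restrict (f \<circ> ?s) (\<kappa> ` V) \<circ> \<kappa>) V = f"
    proof
      fix f assume f: "f \<in> ?F"
      then have "f \<in> extensional V" by (auto simp: colourings_def PiE_iff)
      then show "restrict (restrict (f \<circ> ?s) (\<kappa> ` V) \<circ> \<kappa>) V = f"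
        using class_rep[OF f] by (auto simp: fun_eq_iff restrict_def extensional_def)
    qed
    show "(\<lambda>g. restrict (g \<circ> \<kappa>) V) ` ?G \<subseteq> ?F"
    proof (rule image_subsetI)
      fix g assume "g \<in> ?G"
      then have g: "g \<in> colourings (\<kappa> ` V) (\<lambda>B. card {v \<in> V. \<kappa> v = B}) a" "inj_on g (\<kappa> ` V)"
        by simp_all
      have "(\<Sum>v\<in>V. if restrict (g \<circ> \<kappa>) V v = i then 1 else 0) = (\<Sum>v\<in>V. if g (\<kappa> v) = i then 1 else (0::nat))" for i
        by (intro sum.cong) auto
      then have "restrict (g \<circ> \<kappa>) V \<in> colourings V (\<lambda>_. 1) a"
        using g(1) by (auto simp: colourings_def sums[unfolded One_nat_def])
      then show "restrict (g \<circ> \<kappa>) V \<in> ?F"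
        using g(2) by (auto dest: inj_onD)
    qed
    show "(\<lambda>f. restrict (f \<circ> ?s) (\<kappa> ` V)) ` ?F \<subseteq> ?G"
    proof (rule image_subsetI)
      fix f assume f: "f \<in> ?F"
      let ?g = "restrict (f \<circ> ?s) (\<kappa> ` V)"
      have "(\<Sum>B\<in>\<kappa> ` V. if ?g B = i then card {v \<in> V. \<kappa> v = B} else 0) = (\<Sum>v\<in>V. if f v = i then 1 else 0)" for i
        unfolding sums[symmetric] using class_rep[OF f] by (intro sum.cong) auto
      then have "?g \<in> colourings (\<kappa> ` V) (\<lambda>B. card {v \<in> V. \<kappa> v = B}) a"
        using f by (simp add: colourings_def del: One_nat_def)
      moreover have "inj_on ?g (\<kappa> ` V)"
        using class_rep[OF f] f by (auto simp: inj_on_def)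
      ultimately show "?g \<in> ?G" by simp
    qed
  qed
  then show ?thesis by (rule bij_betw_same_card[symmetric])
qed

section \<open>Power sums count colourings invariant under a permutation\<close>

text \<open>The partition \<open>l\<close> is the cycle type of \<open>\<sigma>\<close>, each cycle measured by its total weight. With
  general weights, the statement can be proved by removing one vertex \<open>x\<close> at a time: a fixed point
  splits off a factor \<open>p\<^bsub>w x\<^esub>\<close>, and any other \<open>x\<close> is merged into its predecessor on its cycle, which
  inherits the weight of \<open>x\<close>. Merging multiplies the sign of \<open>\<sigma>\<close> by \<open>-1\<close> and
  lowers the number of vertices by one, so the sign formula is preserved. For unit weights the
  exponent \<open>sum w V + card V\<close> is even and only \<open>sign \<sigma>\<close> remains.\<close>

lemma power_sum_sym_of_permutation:
  assumes "finite V" "\<And>v. v \<in> V \<Longrightarrow> w v > 0" "\<sigma> permutes V"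
  shows "\<exists>l \<in> int_partitions.
    (\<forall>a. mcoeff (power_sum_sym l :: 'a::comm_ring_1 mps) a =
      of_nat (card {f \<in> colourings V w a. \<forall>v\<in>V. f (\<sigma> v) = f v})) \<and>
    (\<Prod>k\<in>#l. (-1) ^ (k - 1)) = sign \<sigma> * (-1) ^ (sum w V + card V)"
  using assms
proof (induction V arbitrary: w \<sigma> rule: finite_induct)
  case empty
  then have "\<sigma> = id" by simp
  then show ?case
    by (intro bexI[of _ "{#}"])
      (auto simp: power_sum_sym_def int_partitions_def colourings_empty mcoeff_one)
next
  case (insert x V)
  show ?case
  proof (cases "\<sigma> x = x")
    case True
    have perm: "\<sigma> permutes V"
      using insert.prems(2) True by (rule_tac permutes_superset) auto
    have w: "w x > 0" "\<And>v. v \<in> V \<Longrightarrow> w v > 0" using insert.prems by auto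
    from insert.IH[of w \<sigma>, OF w(2) perm] obtain l where l: "l \<in> int_partitions"
      "\<And>a. mcoeff (power_sum_sym l :: 'a mps) a = of_nat (card {f \<in> colourings V w a. \<forall>v\<in>V. f (\<sigma> v) = f v})"
      "(\<Prod>k\<in>#l. (-1) ^ (k - 1)) = sign \<sigma> * (-1) ^ (sum w V + card V)" by blast
    show ?thesis
    proof (intro bexI[of _ "add_mset (w x) l"] conjI allI)
      show "add_mset (w x) l \<in> int_partitions" using l w by (auto simp: int_partitions_def)
      have "(-1::int) ^ (w x - 1) = (-1) ^ (w x + 1)"
        using w(1) by (cases "w x") auto
      then show "(\<Prod>k\<in>#add_mset (w x) l. (-1) ^ (k - 1)) = sign \<sigma> * (-1) ^ (sum w (insert x V) + card (insert x V))"
        using l(3) insert.hyps by (simp add: power_add)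
      fix a
      have "mcoeff (power_sum_sym (add_mset (w x) l) :: 'a mps) a = mcoeff (power_sum_sym l * power_sum_sym {#w x#}) a"
        using power_sum_sym_add[of l "{#w x#}", where ?'a = 'a] by simp
      also have "\<dots> = (\<Sum>j | w x \<le> Poly_Mapping.lookup a j.
          of_nat (card {g \<in> colourings V w (a - Poly_Mapping.single j (w x)). \<forall>v\<in>V. g (\<sigma> v) = g v}))"
        using w by (simp add: mcoeff_mult_power_sum l)
      also have "\<dots> = (\<Sum>j | w x \<le> Poly_Mapping.lookup a j.
          of_nat (card {g \<in> colourings V w (a - Poly_Mapping.single j (w x)).
            \<forall>v\<in>insert x V. (g(x := j)) (\<sigma> v) = (g(x := j)) v}))"
      proof -
        have "(\<forall>v\<in>insert x V. (g(x := j)) (\<sigma> v) = (g(x := j)) v) \<longleftrightarrow> (\<forall>v\<in>V. g (\<sigma> v) = g v)"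
          for g :: "'b \<Rightarrow> nat" and j
          using permutes_in_image[OF perm] insert.hyps True by (auto simp: fun_upd_def)
        then show ?thesis by simp
      qed
      also have "\<dots> = of_nat (card {f \<in> colourings (insert x V) w a. \<forall>v\<in>insert x V. f (\<sigma> v) = f v})"
        using insert.hyps w by (subst card_colourings_insert) auto
      finally show "mcoeff (power_sum_sym (add_mset (w x) l) :: 'a mps) a =
        of_nat (card {f \<in> colourings (insert x V) w a. \<forall>v\<in>insert x V. f (\<sigma> v) = f v})" .
    qed
  next
    case False
    define t where "t = inv \<sigma> x"
    have perm: "\<sigma> permutes insert x V" by fact
    have t: "\<sigma> t = x" using permutes_inverses[OF perm] by (simp add: t_def)
    then have "t \<noteq> x" using False by auto
    moreover have "t \<in> insert x V" using permutes_in_image[OF perm, of t] t by simp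
    ultimately have tV: "t \<in> V" by simp
    \<comment> \<open>This shortcuts \<open>t \<mapsto> x \<mapsto> \<sigma> x\<close> to \<open>t \<mapsto> \<sigma> x\<close> and fixes \<open>x\<close>, which can then be dropped.\<close>
    define \<sigma>' where "\<sigma>' = \<sigma> \<circ> transpose x t"
    define w' where "w' = w(t := w t + w x)"
    have \<sigma>': "\<sigma>' x = x" "\<sigma>' t = \<sigma> x" "\<And>v. v \<noteq> x \<Longrightarrow> v \<noteq> t \<Longrightarrow> \<sigma>' v = \<sigma> v"
      using t by (auto simp: \<sigma>'_def transpose_def)
    have "\<sigma>' permutes insert x V"
      unfolding \<sigma>'_def using perm tV by (intro permutes_compose permutes_swap_id) auto
    then have perm': "\<sigma>' permutes V"
      using \<sigma>' by (rule_tac permutes_superset) auto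
    have sign: "sign \<sigma>' = - sign \<sigma>"
      unfolding \<sigma>'_def using \<open>t \<noteq> x\<close> perm insert.hyps
      by (subst sign_compose) (auto simp: sign_swap_id permutation_swap_id intro: permutes_imp_permutation[of "insert x V"])
    have w': "\<And>v. v \<in> V \<Longrightarrow> w' v > 0" using insert.prems by (auto simp: w'_def)
    have merge: "(\<Sum>v\<in>V. if Q v then w' v else 0) = (\<Sum>v\<in>insert x V. if Q v then w v else 0)"
      if "Q x \<longleftrightarrow> Q t" for Q
    proof -
      have "(\<Sum>v\<in>V. if Q v then w' v else 0) = (if Q t then w' t else 0) + (\<Sum>v\<in>V - {t}. if Q v then w' v else 0)"
        using insert.hyps tV by (simp add: sum.remove)
      also have "(\<Sum>v\<in>V - {t}. if Q v then w' v else 0) = (\<Sum>v\<in>V - {t}. if Q v then w v else 0)"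
        by (intro sum.cong) (auto simp: w'_def)
      also have "(if Q t then w' t else 0) + \<dots> = (if Q x then w x else 0) + (\<Sum>v\<in>V. if Q v then w v else 0)"
        using insert.hyps tV that by (simp add: sum.remove w'_def)
      finally show ?thesis using insert.hyps by simp
    qed
    have "sum w' V = sum w (insert x V)" using merge[of "\<lambda>_. True"] by simp
    moreover from insert.IH[of w' \<sigma>', OF w' perm'] obtain l where l: "l \<in> int_partitions"
      "\<And>a. mcoeff (power_sum_sym l :: 'a mps) a = of_nat (card {f \<in> colourings V w' a. \<forall>v\<in>V. f (\<sigma>' v) = f v})"
      "(\<Prod>k\<in>#l. (-1) ^ (k - 1)) = sign \<sigma>' * (-1) ^ (sum w' V + card V)" by blast
    ultimately have "(\<Prod>k\<in>#l. (-1) ^ (k - 1)) = sign \<sigma> * (-1) ^ (sum w (insert x V) + card (insert x V))"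
      using sign insert.hyps by simp
    moreover have "card {f \<in> colourings V w' a. \<forall>v\<in>V. f (\<sigma>' v) = f v} =
      card {f \<in> colourings (insert x V) w a. \<forall>v\<in>insert x V. f (\<sigma> v) = f v}" (is "card ?F = card ?G") for a
    proof -
      have const: "(\<forall>v\<in>insert x V. f (\<sigma> v) = f v) \<longleftrightarrow> f x = f t \<and> (\<forall>v\<in>V. f (\<sigma>' v) = f v)" for f :: "'b \<Rightarrow> nat"
      proof
        assume *: "\<forall>v\<in>insert x V. f (\<sigma> v) = f v"
        then have "f x = f t" using tV t by (metis insertI2)
        moreover have "f (\<sigma>' v) = f v" if "v \<in> V" for v
        proof (cases "v = t")
          case False
          moreover have "v \<noteq> x" using that insert.hyps by auto
          ultimately show ?thesis using * \<sigma>'(3) that by auto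
        qed (use * \<sigma>' \<open>f x = f t\<close> in auto)
        ultimately show "f x = f t \<and> (\<forall>v\<in>V. f (\<sigma>' v) = f v)" by blast
      next
        assume *: "f x = f t \<and> (\<forall>v\<in>V. f (\<sigma>' v) = f v)"
        show "\<forall>v\<in>insert x V. f (\<sigma> v) = f v"
        proof
          fix v assume v: "v \<in> insert x V"
          consider "v = x" | "v = t" | "v \<in> V" "v \<noteq> x" "v \<noteq> t" using v by blast
          then show "f (\<sigma> v) = f v"
          proof cases
            case 1 then show ?thesis using * \<sigma>'(2) tV by metis
          next
            case 2 then show ?thesis using * t by simp
          next
            case 3 then show ?thesis using * \<sigma>'(3) by metis
          qed
        qed
      qed
      have "bij_betw (\<lambda>f. f(x := f t)) ?F ?G"
      proof (rule bij_betw_byWitness[where f' = "\<lambda>f. restrict f V"])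
        show "\<forall>f\<in>?F. restrict (f(x := f t)) V = f"
          using insert.hyps by (auto simp: colourings_def PiE_iff extensional_def fun_eq_iff restrict_def)
        show "\<forall>f\<in>?G. (restrict f V)(x := restrict f V t) = f"
          unfolding const using tV by (auto simp: colourings_def PiE_iff extensional_def fun_eq_iff restrict_def)
        show "(\<lambda>f. f(x := f t)) ` ?F \<subseteq> ?G"
        proof (rule image_subsetI)
          fix f assume f: "f \<in> ?F"
          let ?f = "f(x := f t)"
          have eq: "?f v = f v" if "v \<in> V" for v using that insert.hyps by auto
          have sum: "(\<Sum>v\<in>insert x V. if ?f v = i then w v else 0) = Poly_Mapping.lookup a i" for i
          proof -
            have "(\<Sum>v\<in>insert x V. if ?f v = i then w v else 0) = (\<Sum>v\<in>V. if ?f v = i then w' v else 0)"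
              using \<open>t \<noteq> x\<close> by (intro merge[symmetric]) simp
            also have "\<dots> = (\<Sum>v\<in>V. if f v = i then w' v else 0)"
              using insert.hyps by (intro sum.cong) auto
            finally show ?thesis using f by (simp add: colourings_def)
          qed
          have "?f \<in> insert x V \<rightarrow>\<^sub>E UNIV"
            using f by (auto simp: colourings_def PiE_iff extensional_def)
          then have "?f \<in> colourings (insert x V) w a"
            using sum unfolding colourings_def by (intro CollectI conjI allI)
          moreover have "?f (\<sigma>' v) = ?f v" if "v \<in> V" for v
            using f that eq permutes_in_image[OF perm', of v] by auto
          ultimately show "?f \<in> ?G" unfolding const using \<open>t \<noteq> x\<close> by simp
        qed
        show "(\<lambda>f. restrict f V) ` ?G \<subseteq> ?F"
        proof (rule image_subsetI)
          fix f assume f: "f \<in> ?G"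
          let ?f = "restrict f V"
          have "(\<Sum>v\<in>V. if ?f v = i then w' v else 0) = Poly_Mapping.lookup a i" for i
          proof -
            have "(\<Sum>v\<in>V. if ?f v = i then w' v else 0) = (\<Sum>v\<in>V. if f v = i then w' v else 0)"
              by (intro sum.cong) auto
            also have "\<dots> = (\<Sum>v\<in>insert x V. if f v = i then w v else 0)"
              using f unfolding const by (intro merge) simp
            finally show ?thesis using f by (simp add: colourings_def)
          qed
          then have "?f \<in> colourings V w' a" by (auto simp: colourings_def)
          moreover have "?f (\<sigma>' v) = ?f v" if "v \<in> V" for v
            using f that permutes_in_image[OF perm', of v] unfolding const by auto
          ultimately show "?f \<in> ?F" by simp
        qed
      qed
      then show ?thesis by (rule bij_betw_same_card)
    qed
    ultimately show ?thesis using l by (intro bexI[of _ l]) auto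
  qed
qed

section \<open>Permutations extending a partial injection\<close>

definition extensions :: "'v set \<Rightarrow> ('v \<Rightarrow> nat) \<Rightarrow> 'v rel \<Rightarrow> ('v \<Rightarrow> 'v) set"
  where "extensions V f S =
    {\<sigma>. \<sigma> permutes V \<and> (\<forall>v\<in>V. f (\<sigma> v) = f v) \<and> (\<forall>(u, v)\<in>S. \<sigma> u = v)}"

lemma sign_comp_transpose:
  assumes "finite V" "\<sigma> permutes V" "a \<noteq> b"
  shows "sign (\<sigma> \<circ> transpose a b) = - sign \<sigma>"
  using assms
  by (subst sign_compose)
    (auto simp: sign_swap_id permutation_swap_id intro: permutes_imp_permutation[of V])

text \<open>The extension closes every path of \<open>S\<close> to a cycle. In the induction an edge \<open>(a, b)\<close> is removed
  whose start \<open>a\<close> has no predecessor. This makes \<open>a\<close> an isolated vertex, so it is given a fresh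
  colour and becomes a fixed point of the permutation \<open>\<sigma>'\<close> for the smaller relation; inserting
  \<open>a\<close> in front of \<open>b\<close> into its cycle costs one transposition and hence one sign.\<close>

lemma extension_exists:
  assumes "finite V" "S \<subseteq> V \<times> V" "acyclic S" "single_valued S" "single_valued (S\<inverse>)"
    and "\<And>u v. (u, v) \<in> S \<Longrightarrow> f u = f v" and "inj_on f (V - Domain S)"
  shows "\<exists>\<sigma> \<in> extensions V f S. sign \<sigma> = (-1) ^ card S"
  using assms
proof (induction "card S" arbitrary: S f)
  case 0
  then have "S = {}" using finite_subset[of S "V \<times> V"] by auto
  then show ?case by (intro bexI[of _ id]) (auto simp: extensions_def permutes_id)
next
  case (Suc n)
  have fin: "finite S" using Suc.prems finite_subset[of S "V \<times> V"] by auto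
  then have "wf S" using Suc.prems by (intro finite_acyclic_wf)
  moreover have "Domain S \<noteq> {}" using Suc.hyps(2) by (auto simp: Domain_empty_iff)
  ultimately obtain a where a: "a \<in> Domain S" "\<And>u. (u, a) \<in> S \<Longrightarrow> u \<notin> Domain S"
    by (metis wfE_min')
  then obtain b where ab: "(a, b) \<in> S" by blast
  have source: "(u, a) \<notin> S" for u using a(2) by blast
  have "a \<noteq> b" using ab source by blast
  have only: "v = b" if "(a, v) \<in> S" for v using that ab Suc.prems by (auto dest: single_valuedD)
  define S' where "S' = S - {(a, b)}"
  have S: "S = insert (a, b) S'" "(a, b) \<notin> S'" using ab by (auto simp: S'_def)
  have not_a: "u \<noteq> a" "v \<noteq> a" if "(u, v) \<in> S'" for u v
    using that only source by (auto simp: S'_def)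
  have V: "a \<in> V" "b \<in> V" using ab Suc.prems by auto
  \<comment> \<open>The vertex \<open>a\<close> is a sink of \<open>S'\<close>; the fresh colour keeps \<open>f'\<close> injective on sinks.\<close>
  obtain c where c: "c \<notin> f ` V" using ex_new_if_finite[of "f ` V"] Suc.prems(1) by auto
  define f' where "f' = f(a := c)"
  have "n = card S'" using Suc.hyps(2) fin ab by (simp add: S'_def)
  moreover have "S' \<subseteq> V \<times> V" "acyclic S'" "single_valued S'" "single_valued (S'\<inverse>)"
    using Suc.prems by (auto simp: S'_def intro: acyclic_subset single_valued_subset)
  moreover have "f' u = f' v" if "(u, v) \<in> S'" for u v
    using not_a[OF that] that Suc.prems(6) by (auto simp: f'_def S'_def)
  moreover have "inj_on f' (V - Domain S')"
  proof -
    have eq: "V - Domain S' = insert a (V - Domain S)" using V not_a S by auto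
    have "inj_on f' (V - Domain S)"
      using Suc.prems(7) a(1) by (auto simp: f'_def inj_on_def)
    moreover have "f' a \<notin> f' ` (V - Domain S)" using c a(1) by (auto simp: f'_def)
    ultimately show ?thesis unfolding eq using a(1) by simp
  qed
  ultimately have "\<exists>\<sigma> \<in> extensions V f' S'. sign \<sigma> = (-1) ^ card S'"
    using Suc.prems(1) by (intro Suc.hyps(1))
  then obtain \<sigma>' where "\<sigma>' \<in> extensions V f' S'" "sign \<sigma>' = (-1) ^ card S'" by blast
  then have \<sigma>': "\<sigma>' permutes V" "\<And>v. v \<in> V \<Longrightarrow> f' (\<sigma>' v) = f' v"
    "\<And>u v. (u, v) \<in> S' \<Longrightarrow> \<sigma>' u = v" and sign: "sign \<sigma>' = (-1) ^ n"
    using \<open>n = card S'\<close> by (auto simp: extensions_def)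
  have fix_a: "\<sigma>' a = a"
  proof (rule ccontr)
    assume "\<sigma>' a \<noteq> a"
    then have "f (\<sigma>' a) = c" using \<sigma>'(2)[OF V(1)] by (simp add: f'_def)
    then show False using c permutes_in_image[OF \<sigma>'(1)] V by blast
  qed
  \<comment> \<open>The predecessor \<open>t\<close> of \<open>b\<close> on the cycle of \<open>\<sigma>'\<close> is the sink that ends the path from \<open>b\<close>; \<open>a\<close> goes between.\<close>
  define t where "t = inv \<sigma>' b"
  have t: "\<sigma>' t = b" using permutes_inverses[OF \<sigma>'(1)] by (simp add: t_def)
  have ta: "t \<noteq> a" "t \<in> V" using t fix_a \<open>a \<noteq> b\<close> permutes_in_image[OF \<sigma>'(1), of t] V by auto
  define \<sigma> where "\<sigma> = \<sigma>' \<circ> transpose a t"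
  have \<sigma>: "\<sigma> a = b" "\<sigma> t = a" "\<And>v. v \<noteq> a \<Longrightarrow> v \<noteq> t \<Longrightarrow> \<sigma> v = \<sigma>' v"
    using t fix_a by (auto simp: \<sigma>_def)
  have f'_eq: "f' v = f v" if "v \<noteq> a" for v using that by (simp add: f'_def)
  have "\<sigma> permutes V"
    unfolding \<sigma>_def using \<sigma>'(1) V ta by (intro permutes_compose permutes_swap_id)
  moreover have "f (\<sigma> v) = f v" if v: "v \<in> V" for v
  proof -
    have fab: "f a = f b" using Suc.prems(6) ab by blast
    consider "v = a" | "v = t" | "v \<noteq> a" "v \<noteq> t" by blast
    then show ?thesis
    proof cases
      case 1 then show ?thesis using \<sigma> fab by simp
    next
      case 2
      have "f b = f t" using \<sigma>'(2)[OF ta(2)] t ta(1) \<open>a \<noteq> b\<close> by (simp add: f'_eq)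
      then show ?thesis using 2 \<sigma> fab by simp
    next
      case 3
      have "\<sigma>' v \<noteq> a" using 3 fix_a permutes_inj[OF \<sigma>'(1)] by (metis injD)
      then show ?thesis using 3 \<sigma> \<sigma>'(2)[OF v] by (simp add: f'_eq)
    qed
  qed
  moreover have "\<sigma> u = v" if "(u, v) \<in> S" for u v
  proof (cases "(u, v) = (a, b)")
    case False
    then have uv: "(u, v) \<in> S'" using that by (simp add: S'_def)
    have "u \<noteq> t"
    proof
      assume "u = t"
      then have "v = b" using \<sigma>'(3)[OF uv] t by simp
      then have "u = a" using that ab Suc.prems(5) by (auto dest: single_valuedD)
      then show False using not_a[OF uv] by simp
    qed
    then show ?thesis using \<sigma> \<sigma>'(3)[OF uv] not_a[OF uv] by simp
  qed (use \<sigma> in auto)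
  moreover have "sign \<sigma> = (-1) ^ card S"
    using sign_comp_transpose[OF Suc.prems(1) \<sigma>'(1), of a t] ta sign
    by (simp add: \<sigma>_def Suc.hyps(2)[symmetric])
  ultimately show ?case unfolding extensions_def by blast
qed

text \<open>On the domain of \<open>S\<close> an extension is prescribed, so its values on the sinks are the remaining
  vertices. Colours are preserved and distinguish the sinks, so there is no choice left.\<close>

lemma extension_unique:
  assumes \<sigma>: "\<sigma> \<in> extensions V f S" and \<tau>: "\<tau> \<in> extensions V f S"
    and inj: "inj_on f (V - Domain S)"
  shows "\<sigma> = \<tau>"
proof
  have perm: "\<sigma> permutes V" "\<tau> permutes V" using \<sigma> \<tau> by (simp_all add: extensions_def)
  have S: "\<sigma> u = \<tau> u" if "u \<in> Domain S" for u
    using that \<sigma> \<tau> unfolding extensions_def by fastforce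
  fix v
  consider "v \<notin> V" | "v \<in> Domain S" | "v \<in> V - Domain S" by blast
  then show "\<sigma> v = \<tau> v"
  proof cases
    case 1
    then show ?thesis using perm by (metis permutes_not_in)
  next
    case 2
    then show ?thesis by (rule S)
  next
    case 3
    define u where "u = inv \<tau> (\<sigma> v)"
    have u: "\<tau> u = \<sigma> v" using permutes_inverses[OF perm(2)] by (simp add: u_def)
    have uV: "u \<in> V" using u 3 permutes_in_image[OF perm(1), of v] permutes_in_image[OF perm(2), of u] by simp
    have "f u = f v" using \<sigma> \<tau> u uV 3 unfolding extensions_def by (metis (mono_tags, lifting) DiffD1 mem_Collect_eq)
    moreover have "u \<notin> Domain S"
    proof
      assume "u \<in> Domain S"
      then have "\<sigma> u = \<sigma> v" using S u by simp
      then have "u = v" using permutes_inj[OF perm(1)] by (simp add: inj_eq)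
      then show False using 3 \<open>u \<in> Domain S\<close> by simp
    qed
    ultimately have "u = v" using inj uV 3 by (auto dest: inj_onD)
    then show ?thesis using u by simp
  qed
qed

text \<open>Exchanging the images of two sinks of the same colour is a sign-reversing involution.\<close>

lemma signed_sum_cancel:
  assumes "finite V" and a: "a \<in> V - Domain S" and b: "b \<in> V - Domain S"
    and "a \<noteq> b" "f a = f b"
  shows "(\<Sum>\<sigma>\<in>extensions V f S. sign \<sigma>) = 0"
proof -
  let ?h = "\<lambda>\<sigma>. \<sigma> \<circ> transpose a b"
  have h: "?h \<sigma> \<in> extensions V f S" if \<sigma>: "\<sigma> \<in> extensions V f S" for \<sigma>
  proof -
    have "?h \<sigma> permutes V"
      using \<sigma> a b by (intro permutes_compose permutes_swap_id) (auto simp: extensions_def)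
    moreover have "f (?h \<sigma> v) = f v" if "v \<in> V" for v
      using \<sigma> that a b assms(5) by (cases "v = a \<or> v = b") (auto simp: extensions_def)
    moreover have "?h \<sigma> u = v" if "(u, v) \<in> S" for u v
    proof -
      have "u \<noteq> a" "u \<noteq> b" using that a b by auto
      then show ?thesis using \<sigma> that by (auto simp: extensions_def)
    qed
    ultimately show ?thesis unfolding extensions_def by blast
  qed
  have inv: "?h (?h \<sigma>) = \<sigma>" for \<sigma> by (simp add: fun_eq_iff)
  have "(\<Sum>\<sigma>\<in>extensions V f S. sign \<sigma>) = (\<Sum>\<sigma>\<in>extensions V f S. sign (?h \<sigma>))"
    using h inv by (intro sum.reindex_bij_witness[of _ ?h ?h]) auto
  also have "\<dots> = (\<Sum>\<sigma>\<in>extensions V f S. - sign \<sigma>)"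
    using assms by (intro sum.cong refl sign_comp_transpose[of V]) (auto simp: extensions_def)
  also have "\<dots> = - (\<Sum>\<sigma>\<in>extensions V f S. sign \<sigma>)" by (simp add: sum_negf)
  finally show ?thesis by simp
qed

lemma signed_sum_extensions:
  assumes "finite V" "S \<subseteq> V \<times> V" "acyclic S"
  shows "(\<Sum>\<sigma>\<in>extensions V f S. sign \<sigma>) =
    (if single_valued S \<and> single_valued (S\<inverse>) \<and> (\<forall>(u, v)\<in>S. f u = f v) \<and> inj_on f (V - Domain S)
     then (-1) ^ card S else 0)"
proof (cases "inj_on f (V - Domain S)")
  case False
  then obtain a b where "a \<in> V - Domain S" "b \<in> V - Domain S" "a \<noteq> b" "f a = f b"
    by (auto simp: inj_on_def)
  then show ?thesis using signed_sum_cancel[OF assms(1)] False by simp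
next
  case inj: True
  show ?thesis
  proof (cases "single_valued S \<and> single_valued (S\<inverse>) \<and> (\<forall>(u, v)\<in>S. f u = f v)")
    case True
    then obtain \<sigma> where "\<sigma> \<in> extensions V f S" "sign \<sigma> = (-1) ^ card S"
      using extension_exists[OF assms, of f] inj by blast
    moreover from this have "extensions V f S = {\<sigma>}" using extension_unique inj by blast
    ultimately show ?thesis using True inj by simp
  next
    case False
    have "\<sigma> \<notin> extensions V f S" for \<sigma>
    proof
      assume "\<sigma> \<in> extensions V f S"
      then have \<sigma>: "\<sigma> permutes V" "\<And>v. v \<in> V \<Longrightarrow> f (\<sigma> v) = f v" "\<And>u v. (u, v) \<in> S \<Longrightarrow> v = \<sigma> u"
        by (auto simp: extensions_def)
      have "single_valued S" using \<sigma>(3) by (auto simp: single_valued_def)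
      moreover have "single_valued (S\<inverse>)"
        using \<sigma>(3) permutes_inj[OF \<sigma>(1)] unfolding single_valued_def converse_iff by (metis injD)
      moreover have "\<forall>(u, v)\<in>S. f u = f v" using \<sigma>(2,3) assms(2) by fastforce
      ultimately show False using False by blast
    qed
    then have "extensions V f S = {}" by blast
    then show ?thesis using False by auto
  qed
qed

lemma sum_Pow_alternating:
  assumes "finite A"
  shows "(\<Sum>S\<in>Pow A. (-1) ^ card S) = (if A = {} then 1 else (0::int))"
  using assms
proof (induction A rule: finite_induct)
  case (insert x A)
  have "(\<Sum>S\<in>Pow (insert x A). (-1) ^ card S) = (\<Sum>S\<in>Pow A. (-1) ^ card S) + (\<Sum>S\<in>insert x ` Pow A. (-1::int) ^ card S)"
    unfolding Pow_insert using insert.hyps by (intro sum.union_disjoint) auto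
  also have "(\<Sum>S\<in>insert x ` Pow A. (-1::int) ^ card S) = (\<Sum>S\<in>Pow A. (-1) ^ card (insert x S))"
    using insert.hyps by (subst sum.reindex) (auto simp: inj_on_def)
  also have "\<dots> = (\<Sum>S\<in>Pow A. - ((-1) ^ card S))"
  proof (intro sum.cong refl)
    fix S assume "S \<in> Pow A"
    then have "finite S" "x \<notin> S" using insert.hyps finite_subset by auto
    then show "(-1::int) ^ card (insert x S) = - ((-1) ^ card S)" by simp
  qed
  finally show ?case by (simp add: sum_negf)
qed simp

section \<open>Components of a partial injection\<close>

definition component :: "'v rel \<Rightarrow> 'v \<Rightarrow> 'v set"
  where "component S v = (S \<union> S\<inverse>)\<^sup>* `` {v}"

lemma sym_component_rel: "sym ((S \<union> S\<inverse>)\<^sup>*)"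
  by (intro sym_rtrancl) (auto simp: sym_def)

lemma component_eq_iff: "component S u = component S v \<longleftrightarrow> (u, v) \<in> (S \<union> S\<inverse>)\<^sup>*"
proof
  assume "component S u = component S v"
  then have "v \<in> component S u" by (simp add: component_def)
  then show "(u, v) \<in> (S \<union> S\<inverse>)\<^sup>*" by (simp add: component_def)
next
  assume "(u, v) \<in> (S \<union> S\<inverse>)\<^sup>*"
  then show "component S u = component S v"
    using sym_component_rel[of S] by (auto simp: component_def dest: symD intro: rtrancl_trans)
qed

text \<open>In a partial injection a zigzag can never branch, so it can be straightened to a path.\<close>

lemma single_valued_component_cases:
  assumes "single_valued S" "single_valued (S\<inverse>)" "(u, v) \<in> (S \<union> S\<inverse>)\<^sup>*"
  shows "(u, v) \<in> S\<^sup>* \<or> (v, u) \<in> S\<^sup>*"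
  using assms(3)
proof (induction rule: rtrancl_induct)
  case (step v w)
  from step.IH show ?case
  proof
    assume uv: "(u, v) \<in> S\<^sup>*"
    show ?thesis
    proof (cases "(v, w) \<in> S")
      case False
      then have wv: "(w, v) \<in> S" using step.hyps by auto
      from uv show ?thesis
      proof (cases rule: rtranclE)
        case base
        then show ?thesis using wv by blast
      next
        case (step x)
        then have "x = w" using wv assms(2) by (auto dest: single_valuedD)
        then show ?thesis using step by blast
      qed
    qed (use uv in auto)
  next
    assume vu: "(v, u) \<in> S\<^sup>*"
    show ?thesis
    proof (cases "(v, w) \<in> S")
      case True
      from vu show ?thesis
      proof (cases rule: converse_rtranclE)
        case base
        then show ?thesis using True by blast
      next
        case (step x)
        then have "x = w" using True assms(1) by (auto dest: single_valuedD)
        then show ?thesis using step by blast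
      qed
    next
      case False
      then have "(w, v) \<in> S" using step.hyps by auto
      then show ?thesis using vu by (meson converse_rtrancl_into_rtrancl)
    qed
  qed
qed simp

lemma reaches_sink:
  assumes "finite S" "acyclic S"
  shows "\<exists>s. (v, s) \<in> S\<^sup>* \<and> s \<notin> Domain S"
proof -
  have "wf (S\<inverse>)" using assms by (intro finite_acyclic_wf_converse)
  then show ?thesis
  proof (induction v rule: wf_induct_rule)
    case (less v)
    then show ?case
      by (cases "v \<in> Domain S") (metis DomainE converse_iff converse_rtrancl_into_rtrancl, blast)
  qed
qed

text \<open>From every vertex a path leads to a sink, and each component contains only one sink.\<close>

lemma kernel_eq_components_iff:
  assumes "finite V" "S \<subseteq> V \<times> V" "acyclic S" "single_valued S" "single_valued (S\<inverse>)"
  shows "(\<forall>(u, v)\<in>S. f u = f v) \<and> inj_on f (V - Domain S) \<longleftrightarrow>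
    (\<forall>u\<in>V. \<forall>v\<in>V. f u = f v \<longleftrightarrow> component S u = component S v)"
proof
  assume L: "(\<forall>(u, v)\<in>S. f u = f v) \<and> inj_on f (V - Domain S)"
  have const: "f u = f v" if "(u, v) \<in> (S \<union> S\<inverse>)\<^sup>*" for u v
    using that by (induction rule: rtrancl_induct) (use L in auto)
  have fin: "finite S" using assms finite_subset[of S "V \<times> V"] by auto
  have sink: "\<exists>s \<in> V - Domain S. (u, s) \<in> (S \<union> S\<inverse>)\<^sup>*" if "u \<in> V" for u
  proof -
    obtain s where s: "(u, s) \<in> S\<^sup>*" "s \<notin> Domain S" using reaches_sink[OF fin assms(3)] by blast
    have "s \<in> V" using s(1) that assms(2) by (induction rule: rtrancl_induct) auto
    moreover have "(u, s) \<in> (S \<union> S\<inverse>)\<^sup>*" using s(1) rtrancl_mono[of S "S \<union> S\<inverse>"] by blast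
    ultimately show ?thesis using s by blast
  qed
  show "\<forall>u\<in>V. \<forall>v\<in>V. f u = f v \<longleftrightarrow> component S u = component S v"
  proof (intro ballI iffI)
    fix u v assume uv: "u \<in> V" "v \<in> V" "f u = f v"
    obtain s t where st: "s \<in> V - Domain S" "(u, s) \<in> (S \<union> S\<inverse>)\<^sup>*"
      "t \<in> V - Domain S" "(v, t) \<in> (S \<union> S\<inverse>)\<^sup>*" using sink uv by blast
    then have "f s = f t" using const uv by metis
    then have "s = t" using L st by (auto dest: inj_onD)
    then show "component S u = component S v" using st component_eq_iff by metis
  next
    fix u v assume "component S u = component S v"
    then show "f u = f v" using const component_eq_iff by metis
  qed
next
  assume R: "\<forall>u\<in>V. \<forall>v\<in>V. f u = f v \<longleftrightarrow> component S u = component S v"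
  have "f u = f v" if "(u, v) \<in> S" for u v
  proof -
    have "component S u = component S v" using that by (auto simp: component_eq_iff)
    then show ?thesis using R that assms(2) by blast
  qed
  moreover have "inj_on f (V - Domain S)"
  proof (rule inj_onI)
    fix u v assume uv: "u \<in> V - Domain S" "v \<in> V - Domain S" "f u = f v"
    then have "(u, v) \<in> (S \<union> S\<inverse>)\<^sup>*" using R by (auto simp flip: component_eq_iff)
    then have "(u, v) \<in> S\<^sup>* \<or> (v, u) \<in> S\<^sup>*" by (rule single_valued_component_cases[OF assms(4,5)])
    then show "u = v" using uv by (auto elim: converse_rtranclE)
  qed
  ultimately show "(\<forall>(u, v)\<in>S. f u = f v) \<and> inj_on f (V - Domain S)" by blast
qed

text \<open>In an acyclic digraph these are the path covers, a description that makes no reference to any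
  decomposition into paths.\<close>

definition partial_injections :: "'v rel \<Rightarrow> 'v rel set"
  where "partial_injections E = {S. S \<subseteq> E \<and> single_valued S \<and> single_valued (S\<inverse>)}"

text \<open>Inclusion-exclusion: the alternating sum over the sets \<open>S\<close> of edges used by \<open>\<sigma>\<close> is \<open>1\<close> if
  \<open>\<sigma>\<close> avoids \<open>E\<close> and \<open>0\<close> otherwise. After exchanging the sums, \<open>signed_sum_extensions\<close> evaluates the
  sum over \<open>\<sigma>\<close>, and its sign cancels the one from inclusion-exclusion.\<close>

lemma card_covers_with_kernel:
  fixes f :: "'v \<Rightarrow> nat"
  assumes "finite V" "E \<subseteq> V \<times> V" "acyclic E"
  shows "int (card {S \<in> partial_injections E. \<forall>u\<in>V. \<forall>v\<in>V. f u = f v \<longleftrightarrow> component S u = component S v}) =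
    (\<Sum>\<sigma> | \<sigma> permutes V \<and> (\<forall>v\<in>V. f (\<sigma> v) = f v) \<and> (\<forall>v\<in>V. (v, \<sigma> v) \<notin> E). sign \<sigma>)"
    (is "int (card ?K) = sum sign ?A")
proof -
  have finE: "finite E" using assms finite_subset[of E "V \<times> V"] by auto
  let ?Y = "{\<sigma>. \<sigma> permutes V \<and> (\<forall>v\<in>V. f (\<sigma> v) = f v)}"
  let ?E = "\<lambda>\<sigma>. {(u, v) \<in> E. \<sigma> u = v}"
  have finY: "finite ?Y" using finite_permutations[OF assms(1)] by (rule finite_subset[rotated]) auto
  have ext: "extensions V f S = {\<sigma> \<in> ?Y. S \<subseteq> {(u, v). \<sigma> u = v}}" for S
    by (auto simp: extensions_def)
  have S: "S \<subseteq> V \<times> V" "acyclic S" if "S \<in> Pow E" for S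
    using that assms by (auto intro: acyclic_subset)
  have "sum sign ?A = (\<Sum>\<sigma>\<in>?Y. if ?E \<sigma> = {} then sign \<sigma> else 0)"
  proof (subst sum.inter_filter[OF finY, symmetric], rule sum.cong)
    show "?A = {\<sigma> \<in> ?Y. ?E \<sigma> = {}}" using assms(2) by auto
  qed simp
  also have "\<dots> = (\<Sum>\<sigma>\<in>?Y. sign \<sigma> * (\<Sum>S\<in>Pow (?E \<sigma>). (-1) ^ card S))"
  proof (intro sum.cong refl)
    fix \<sigma>
    have "finite (?E \<sigma>)" using finE by (rule finite_subset[rotated]) auto
    then show "(if ?E \<sigma> = {} then sign \<sigma> else 0) = sign \<sigma> * (\<Sum>S\<in>Pow (?E \<sigma>). (-1) ^ card S)"
      by (cases "?E \<sigma> = {}") (simp_all only: sum_Pow_alternating if_True if_False mult_1_right mult_zero_right simp_thms)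
  qed
  also have "\<dots> = (\<Sum>\<sigma>\<in>?Y. \<Sum>S | S \<in> Pow E \<and> S \<subseteq> {(u, v). \<sigma> u = v}. (-1) ^ card S * sign \<sigma>)"
    unfolding sum_distrib_left by (intro sum.cong) auto
  also have "\<dots> = (\<Sum>S\<in>Pow E. \<Sum>\<sigma> | \<sigma> \<in> ?Y \<and> S \<subseteq> {(u, v). \<sigma> u = v}. (-1) ^ card S * sign \<sigma>)"
    using finY finE by (intro sum.swap_restrict) auto
  also have "\<dots> = (\<Sum>S\<in>Pow E. (-1) ^ card S * (\<Sum>\<sigma>\<in>extensions V f S. sign \<sigma>))"
    unfolding ext sum_distrib_left by simp
  also have "\<dots> = (\<Sum>S\<in>Pow E. if S \<in> ?K then 1 else 0)"
  proof (intro sum.cong refl)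
    fix S assume SE: "S \<in> Pow E"
    have "S \<in> ?K \<longleftrightarrow> single_valued S \<and> single_valued (S\<inverse>) \<and> (\<forall>(u, v)\<in>S. f u = f v) \<and> inj_on f (V - Domain S)"
      using kernel_eq_components_iff[OF assms(1) S[OF SE], of f] SE unfolding partial_injections_def by blast
    then show "(-1) ^ card S * (\<Sum>\<sigma>\<in>extensions V f S. sign \<sigma>) = (if S \<in> ?K then 1 else 0)"
      unfolding signed_sum_extensions[OF assms(1) S[OF SE]] by (simp flip: power_add)
  qed
  also have "\<dots> = int (card ?K)"
  proof -
    have "{S \<in> Pow E. S \<in> ?K} = ?K" by (auto simp: partial_injections_def)
    then show ?thesis using finE by (simp add: sum.If_cases Int_def)
  qed
  finally show ?thesis by simp
qed

section \<open>Path covers of an acyclic digraph\<close>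

definition list_dipath :: "'v list \<Rightarrow> 'v pair_pre_digraph"
  where "list_dipath xs = \<lparr>pverts = set xs, parcs = set (zip xs (tl xs))\<rparr>"

lemma pcas_imp_zip: "pcas u p v \<Longrightarrow> p = zip (pawalk_verts u p) (tl (pawalk_verts u p))"
proof (induction p arbitrary: u)
  case (Cons e es)
  obtain y ys where ys: "pawalk_verts (snd e) es = y # ys" by (cases es) auto
  then have "y = snd e" using Cons.prems by (cases es) auto
  then show ?case using Cons.IH[of "snd e"] Cons.prems ys by (cases e) simp
qed simp

lemma zip_is_pcas:
  "xs \<noteq> [] \<Longrightarrow> pcas (hd xs) (zip xs (tl xs)) (last xs) \<and> pawalk_verts (hd xs) (zip xs (tl xs)) = xs"
proof (induction xs)
  case (Cons x xs)
  then show ?case by (cases xs) auto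
qed simp

text \<open>A path is recovered from the list of its vertices, which is easier to modify than its arcs.\<close>

lemma is_dipath_iff: "is_dipath H \<longleftrightarrow> (\<exists>xs. xs \<noteq> [] \<and> distinct xs \<and> H = list_dipath xs)"
proof
  assume "is_dipath H"
  then obtain u p v where p: "pcas u p v" "distinct (pawalk_verts u p)"
    "pverts H = set (pawalk_verts u p)" "parcs H = set p"
    by (auto simp: is_dipath_def pre_digraph.apath_def pre_digraph.awalk_def
        cas_with_proj_eq awalk_verts_with_proj_eq)
  moreover have "pawalk_verts u p \<noteq> []" by (cases p) auto
  moreover have "H = list_dipath (pawalk_verts u p)"
    using p pcas_imp_zip[OF p(1)] by (simp add: list_dipath_def)
  ultimately show "\<exists>xs. xs \<noteq> [] \<and> distinct xs \<and> H = list_dipath xs" by blast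
next
  assume "\<exists>xs. xs \<noteq> [] \<and> distinct xs \<and> H = list_dipath xs"
  then obtain xs where xs: "xs \<noteq> []" "distinct xs" "H = list_dipath xs" by blast
  then show "is_dipath H"
    using zip_is_pcas[OF xs(1)]
    unfolding is_dipath_def pre_digraph.apath_def pre_digraph.awalk_def
      cas_with_proj_eq awalk_verts_with_proj_eq
    by (intro exI[of _ "hd xs"] exI[of _ "zip xs (tl xs)"] exI[of _ "last xs"]) (auto simp: list_dipath_def)
qed

lemma in_zip_tl_iff: "(u, v) \<in> set (zip xs (tl xs)) \<longleftrightarrow> (\<exists>i. Suc i < length xs \<and> u = xs ! i \<and> v = xs ! Suc i)"
  by (force simp: in_set_zip nth_tl)

lemma no_dicycle:
  assumes "pair_fin_digraph D" "\<nexists>p. pre_digraph.cycle (with_proj D) p" "parcs H \<subseteq> parcs D"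
  shows "\<not> is_dicycle H"
proof
  interpret pair_fin_digraph D by fact
  assume "is_dicycle H"
  then obtain p u where p: "pcas u p u" "distinct (tl (pawalk_verts u p))" "p \<noteq> []" "set p \<subseteq> parcs H"
    by (auto simp: is_dicycle_def pre_digraph.cycle_def pre_digraph.awalk_def
        cas_with_proj_eq awalk_verts_with_proj_eq)
  then have "fst (hd p) = u" "hd p \<in> parcs D" using assms(3) by (cases p; auto)+
  then have "u \<in> pverts D" using arc_fst_in_verts by blast
  then have "pre_digraph.cycle (with_proj D) p"
    unfolding pre_digraph.cycle_def pre_digraph.awalk_def cas_with_proj_eq awalk_verts_with_proj_eq
    using p assms(3) by auto
  then show False using assms(2) by blast
qed

lemma acyclic_parcs:
  assumes "pair_fin_digraph D" "\<nexists>p. pre_digraph.cycle (with_proj D) p"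
  shows "acyclic (parcs D)"
proof (rule acyclicI, rule allI, rule notI)
  interpret pair_fin_digraph D by fact
  have walk: "\<exists>p. p \<noteq> [] \<and> set p \<subseteq> parcs D \<and> pcas u p v" if "(u, v) \<in> (parcs D)\<^sup>+" for u v
    using that
  proof (induction rule: converse_trancl_induct)
    case (base y)
    then show ?case by (intro exI[of _ "[(y, v)]"]) auto
  next
    case (step y z)
    then obtain p where "p \<noteq> []" "set p \<subseteq> parcs D" "pcas z p v" by blast
    then show ?case using step.hyps by (intro exI[of _ "(y, z) # p"]) auto
  qed
  fix x assume "(x, x) \<in> (parcs D)\<^sup>+"
  then obtain p where p: "p \<noteq> []" "set p \<subseteq> parcs D" "pcas x p x" using walk by blast
  then have "hd p \<in> parcs D" "fst (hd p) = x" by (cases p; auto)+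
  then have "x \<in> pverts D" using arc_fst_in_verts by blast
  then have "closed_w p" using p by (auto simp: closed_w_def awalk_def)
  then show False using closed_w_imp_cycle assms(2) by blast
qed

text \<open>Remove a vertex \<open>a\<close> without predecessor. In the decomposition of the rest, the successor of \<open>a\<close>, if
  there is one, has lost its only predecessor and therefore starts its path, so \<open>a\<close> can be put in
  front.\<close>

lemma path_lists_exist:
  assumes "finite V" "S \<subseteq> V \<times> V" "acyclic S" "single_valued S" "single_valued (S\<inverse>)"
  shows "\<exists>X. (\<forall>xs\<in>X. xs \<noteq> [] \<and> distinct xs) \<and> (\<forall>xs\<in>X. \<forall>ys\<in>X. xs \<noteq> ys \<longrightarrow> set xs \<inter> set ys = {}) \<and>
    V = (\<Union>xs\<in>X. set xs) \<and> S = (\<Union>xs\<in>X. set (zip xs (tl xs)))"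
  using assms
proof (induction V arbitrary: S rule: finite_psubset_induct)
  case (psubset V)
  show ?case
  proof (cases "V = {}")
    case True
    then show ?thesis using psubset.prems by (intro exI[of _ "{}"]) auto
  next
    case False
    have fin: "finite S" using psubset finite_subset[of S "V \<times> V"] by auto
    then have "wf S" using psubset.prems by (intro finite_acyclic_wf)
    then obtain a where a: "a \<in> V" "\<And>u. (u, a) \<in> S \<Longrightarrow> u \<notin> V"
      using False by (metis wfE_min')
    have source: "(u, a) \<notin> S" for u using a psubset.prems(1) by blast
    define S' where "S' = {e \<in> S. fst e \<noteq> a}"
    have S': "S' \<subseteq> (V - {a}) \<times> (V - {a})" "S' \<subseteq> S"
      using psubset.prems(1) source by (auto simp: S'_def)
    have "V - {a} \<subset> V" using a(1) by blast
    moreover have "acyclic S'" using S'(2) psubset.prems(2) by (rule acyclic_subset[rotated])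
    moreover have "single_valued S'" "single_valued (S'\<inverse>)"
      using S'(2) psubset.prems(3,4) unfolding single_valued_def by blast+
    ultimately have "\<exists>X. (\<forall>xs\<in>X. xs \<noteq> [] \<and> distinct xs) \<and>
        (\<forall>xs\<in>X. \<forall>ys\<in>X. xs \<noteq> ys \<longrightarrow> set xs \<inter> set ys = {}) \<and>
        V - {a} = (\<Union>xs\<in>X. set xs) \<and> S' = (\<Union>xs\<in>X. set (zip xs (tl xs)))"
      using S'(1) by (intro psubset.IH)
    then obtain X where X0: "\<forall>xs\<in>X. xs \<noteq> [] \<and> distinct xs"
        "\<forall>xs\<in>X. \<forall>ys\<in>X. xs \<noteq> ys \<longrightarrow> set xs \<inter> set ys = {}"
        "V - {a} = (\<Union>xs\<in>X. set xs)" "S' = (\<Union>xs\<in>X. set (zip xs (tl xs)))"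
      by (elim exE conjE) (rule that)
    have X: "\<And>xs. xs \<in> X \<Longrightarrow> xs \<noteq> [] \<and> distinct xs"
        "\<And>xs ys. xs \<in> X \<Longrightarrow> ys \<in> X \<Longrightarrow> xs \<noteq> ys \<Longrightarrow> set xs \<inter> set ys = {}"
      using X0(1,2) by blast+
    note X = X X0(3,4)
    have aX: "a \<notin> set xs" if "xs \<in> X" for xs using X(3) that by auto
    show ?thesis
    proof (cases "a \<in> Domain S")
      case False
      then have "S' = S" by (auto simp: S'_def)
      then show ?thesis using X aX a(1)
        by (intro exI[of _ "insert [a] X"]) auto
    next
      case True
      then obtain b where ab: "(a, b) \<in> S" by blast
      then have S: "S = insert (a, b) S'" using psubset.prems(3) by (auto simp: S'_def dest: single_valuedD)
      have "b \<in> V - {a}" using ab source psubset.prems(1) by auto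
      then obtain xs where xs: "xs \<in> X" "b \<in> set xs" using X(3) by auto
      have hd: "hd xs = b"
      proof -
        obtain i where i: "i < length xs" "b = xs ! i" using xs(2) by (auto simp: in_set_conv_nth)
        show ?thesis
        proof (cases i)
          case 0
          then show ?thesis using i by (simp add: hd_conv_nth)
        next
          case (Suc j)
          then have "(xs ! j, b) \<in> set (zip xs (tl xs))" using i by (auto simp: in_zip_tl_iff)
          then have "(xs ! j, b) \<in> S'" using X(4) xs(1) by auto
          then have "xs ! j = a" using ab psubset.prems(4) S'(2) by (auto dest: single_valuedD)
          then show ?thesis using aX[OF xs(1)] i Suc by (metis Suc_lessD nth_mem)
        qed
      qed
      have zip: "set (zip (a # xs) (tl (a # xs))) = insert (a, b) (set (zip xs (tl xs)))"
        using X(1)[OF xs(1)] hd by (cases xs) auto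
      let ?X = "insert (a # xs) (X - {xs})"
      show ?thesis
      proof (intro exI[of _ ?X] conjI)
        show "\<forall>ys\<in>?X. ys \<noteq> [] \<and> distinct ys" using X(1) xs(1) aX by auto
        have "set (a # xs) \<inter> set ys = {}" if "ys \<in> X - {xs}" for ys
          using X(2)[of xs ys] xs(1) aX that by auto
        then show "\<forall>ys\<in>?X. \<forall>zs\<in>?X. ys \<noteq> zs \<longrightarrow> set ys \<inter> set zs = {}"
          using X(2) by blast
        have "(\<Union>ys\<in>?X. set ys) = insert a (\<Union>ys\<in>X. set ys)" using xs(1) by auto
        then show "V = (\<Union>ys\<in>?X. set ys)" unfolding X(3)[symmetric] using a(1) by (simp add: insert_absorb)
        have "(\<Union>ys\<in>?X. set (zip ys (tl ys))) = insert (a, b) (\<Union>ys\<in>X. set (zip ys (tl ys)))"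
          unfolding UN_insert zip using xs(1) by blast
        then show "S = (\<Union>ys\<in>?X. set (zip ys (tl ys)))" using X(4) S by simp
      qed
    qed
  qed
qed

context
  fixes D :: "'v pair_pre_digraph"
  assumes D: "pair_fin_digraph D" and no_cycle: "\<nexists>p. pre_digraph.cycle (with_proj D) p"
begin

lemma decomp_no_cycles:
  assumes "path_cycle_decomp V S P C" "S \<subseteq> parcs D"
  shows "C = {}"
proof (rule ccontr)
  assume "C \<noteq> {}"
  then obtain H where "H \<in> C" by blast
  then have "is_dicycle H" "parcs H \<subseteq> S" using assms(1) unfolding path_cycle_decomp_def by blast+
  then show False using no_dicycle[OF D no_cycle, of H] assms(2) by blast
qed

text \<open>Vertex-disjointness forces an edge that touches a path to belong to that path. So the paths
  of any decomposition are the components of the edge set, and the blocks do not depend on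
  the decomposition.\<close>

lemma decomp_path:
  assumes dec: "path_cycle_decomp V S P C" and "S \<subseteq> parcs D" and H: "H \<in> P" and u: "u \<in> pverts H"
  shows "pverts H = component S u"
    and "\<exists>xs. distinct xs \<and> pverts H = set xs \<and>
      (\<forall>v w. (v, w) \<in> S \<and> (v \<in> pverts H \<or> w \<in> pverts H) \<longrightarrow> (v, w) \<in> set (zip xs (tl xs)))"
proof -
  have C: "C = {}" by (rule decomp_no_cycles[OF assms(1,2)])
  have dis: "pverts H1 \<inter> pverts H2 = {}" if "H1 \<in> P" "H2 \<in> P" "H1 \<noteq> H2" for H1 H2
    using dec that unfolding path_cycle_decomp_def disjoint_family_on_def C by blast
  have S: "S = (\<Union>H\<in>P. parcs H)" using dec by (simp add: path_cycle_decomp_def C)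
  have list: "\<exists>xs. xs \<noteq> [] \<and> distinct xs \<and> H' = list_dipath xs" if "H' \<in> P" for H'
    using dec that by (simp add: path_cycle_decomp_def is_dipath_iff)
  have ends: "v \<in> pverts H' \<and> w \<in> pverts H'" if "H' \<in> P" "(v, w) \<in> parcs H'" for H' v w
  proof -
    obtain xs where xs: "H' = list_dipath xs" using list \<open>H' \<in> P\<close> by blast
    then show ?thesis using that(2) by (auto simp: list_dipath_def in_zip_tl_iff)
  qed
  have arcs: "(v, w) \<in> parcs H" if vw: "(v, w) \<in> S" and or: "v \<in> pverts H \<or> w \<in> pverts H" for v w
  proof -
    obtain H' where H': "H' \<in> P" "(v, w) \<in> parcs H'" using vw S by auto
    then have "H' = H" using ends[OF H'] dis[OF H' (1) H] or by blast
    then show ?thesis using H' by simp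
  qed
  obtain xs where xs: "xs \<noteq> []" "distinct xs" "H = list_dipath xs" using list H by blast
  then have H_xs: "pverts H = set xs" "parcs H = set (zip xs (tl xs))" by (simp_all add: list_dipath_def)
  show "\<exists>xs. distinct xs \<and> pverts H = set xs \<and>
      (\<forall>v w. (v, w) \<in> S \<and> (v \<in> pverts H \<or> w \<in> pverts H) \<longrightarrow> (v, w) \<in> set (zip xs (tl xs)))"
    using xs(2) H_xs arcs by (intro exI[of _ xs]) auto
  show "pverts H = component S u"
  proof
    have conn: "(xs ! 0, xs ! i) \<in> (S \<union> S\<inverse>)\<^sup>*" if "i < length xs" for i
      using that
    proof (induction i)
      case (Suc i)
      then have "(xs ! i, xs ! Suc i) \<in> parcs H" unfolding H_xs in_zip_tl_iff by blast
      then have "(xs ! i, xs ! Suc i) \<in> S \<union> S\<inverse>" using S H by auto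
      then show ?case using Suc by (meson Suc_lessD rtrancl.rtrancl_into_rtrancl)
    qed simp
    show "pverts H \<subseteq> component S u"
    proof
      fix v assume "v \<in> pverts H"
      then obtain i j where "i < length xs" "u = xs ! i" "j < length xs" "v = xs ! j"
        using u H_xs by (metis in_set_conv_nth)
      then have "(u, v) \<in> (S \<union> S\<inverse>)\<^sup>*"
        using conn[of i] conn[of j] sym_component_rel[of S] by (meson rtrancl_trans symD)
      then show "v \<in> component S u" by (simp add: component_def)
    qed
    show "component S u \<subseteq> pverts H"
    proof
      fix v assume "v \<in> component S u"
      then have "(u, v) \<in> (S \<union> S\<inverse>)\<^sup>*" by (simp add: component_def)
      then show "v \<in> pverts H"
        by (induction rule: rtrancl_induct) (use u ends[OF H] arcs in blast)+
    qed
  qed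
qed

lemma path_cycle_covers_eq: "path_cycle_covers D = partial_injections (parcs D)"
proof (intro equalityI subsetI)
  interpret pair_fin_digraph D by (rule D)
  fix S assume "S \<in> path_cycle_covers D"
  then obtain P C where S: "S \<subseteq> parcs D" and dec: "path_cycle_decomp (pverts D) S P C"
    by (auto simp: path_cycle_covers_def)
  have cover: "\<exists>H\<in>P. v \<in> pverts H" if "v \<in> pverts D" for v
    using that dec decomp_no_cycles[OF dec S] unfolding path_cycle_decomp_def by auto
  have "w = w'" if "(v, w) \<in> S" "(v, w') \<in> S" for v w w'
  proof -
    have "v \<in> pverts D" using that S in_arcsD1 by blast
    then obtain H where H: "H \<in> P" "v \<in> pverts H" using cover by blast
    obtain xs where "distinct xs" "(v, w) \<in> set (zip xs (tl xs))" "(v, w') \<in> set (zip xs (tl xs))"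
      using decomp_path(2)[OF dec S H] \<open>(v, w) \<in> S\<close> \<open>(v, w') \<in> S\<close> H(2) by metis
    then show ?thesis by (auto simp: in_zip_tl_iff nth_eq_iff_index_eq)
  qed
  moreover have "v = v'" if "(v, w) \<in> S" "(v', w) \<in> S" for v v' w
  proof -
    have "w \<in> pverts D" using that S in_arcsD2 by blast
    then obtain H where H: "H \<in> P" "w \<in> pverts H" using cover by blast
    obtain xs where "distinct xs" "(v, w) \<in> set (zip xs (tl xs))" "(v', w) \<in> set (zip xs (tl xs))"
      using decomp_path(2)[OF dec S H] \<open>(v, w) \<in> S\<close> \<open>(v', w) \<in> S\<close> H(2) by metis
    then show ?thesis by (auto simp: in_zip_tl_iff nth_eq_iff_index_eq)
  qed
  ultimately show "S \<in> partial_injections (parcs D)"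
    using S by (auto simp: partial_injections_def single_valued_def)
next
  interpret pair_fin_digraph D by (rule D)
  fix S assume "S \<in> partial_injections (parcs D)"
  then have S: "S \<subseteq> parcs D" "single_valued S" "single_valued (S\<inverse>)" by (auto simp: partial_injections_def)
  have "S \<subseteq> pverts D \<times> pverts D" using S(1) in_arcsD1 in_arcsD2 by auto
  moreover have "acyclic S" using acyclic_subset[OF acyclic_parcs[OF D no_cycle] S(1)] .
  ultimately obtain X where X: "\<forall>xs\<in>X. xs \<noteq> [] \<and> distinct xs" "\<forall>xs\<in>X. \<forall>ys\<in>X. xs \<noteq> ys \<longrightarrow> set xs \<inter> set ys = {}"
    "pverts D = (\<Union>xs\<in>X. set xs)" "S = (\<Union>xs\<in>X. set (zip xs (tl xs)))"
    using path_lists_exist[OF pair_finite_verts _ _ S(2,3)] by blast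
  have "path_cycle_decomp (pverts D) S (list_dipath ` X) {}"
    unfolding path_cycle_decomp_def
  proof (intro conjI)
    show "\<forall>H\<in>list_dipath ` X. is_dipath H" using X(1) by (auto simp: is_dipath_iff)
    show "disjoint_family_on pverts (list_dipath ` X \<union> {})"
      unfolding disjoint_family_on_def
    proof (intro ballI impI)
      fix G H assume "G \<in> list_dipath ` X \<union> {}" "H \<in> list_dipath ` X \<union> {}" "G \<noteq> H"
      then obtain xs ys where "xs \<in> X" "ys \<in> X" "G = list_dipath xs" "H = list_dipath ys" "xs \<noteq> ys" by auto
      then show "pverts G \<inter> pverts H = {}" using X(2) by (auto simp: list_dipath_def)
    qed
  qed (use X in \<open>auto simp: list_dipath_def\<close>)
  then show "S \<in> path_cycle_covers D" using S(1) by (auto simp: path_cycle_covers_def)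
qed

lemma path_blocks_eq:
  assumes "S \<in> path_cycle_covers D"
  shows "path_blocks D S = component S ` pverts D"
proof -
  have S: "S \<subseteq> parcs D" using assms by (simp add: path_cycle_covers_def)
  have blocks: "pverts ` P = component S ` pverts D" if dec: "path_cycle_decomp (pverts D) S P C" for P C
  proof (intro equalityI subsetI)
    have V: "pverts D = (\<Union>H\<in>P. pverts H)"
      using dec decomp_no_cycles[OF dec S] by (simp add: path_cycle_decomp_def)
    fix U
    { assume "U \<in> pverts ` P"
      then obtain H where H: "H \<in> P" "U = pverts H" by blast
      then have "is_dipath H" using dec by (simp add: path_cycle_decomp_def)
      then have "pverts H \<noteq> {}" by (auto simp: is_dipath_iff list_dipath_def)
      then obtain u where "u \<in> pverts H" by blast
      then show "U \<in> component S ` pverts D"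
        using decomp_path(1)[OF dec S H(1)] H V by blast }
    { assume "U \<in> component S ` pverts D"
      then obtain u H where u: "U = component S u" "H \<in> P" "u \<in> pverts H" using V by auto
      then show "U \<in> pverts ` P" using decomp_path(1)[OF dec S u(2,3)] by blast }
  qed
  obtain P C where dec: "path_cycle_decomp (pverts D) S P C"
    using assms by (auto simp: path_cycle_covers_def)
  show ?thesis
  proof (intro equalityI subsetI)
    fix U assume "U \<in> path_blocks D S"
    then show "U \<in> component S ` pverts D" unfolding path_blocks_def using blocks by blast
  next
    fix U assume "U \<in> component S ` pverts D"
    then have "U \<in> pverts ` P" by (simp only: blocks[OF dec])
    then show "U \<in> path_blocks D S" unfolding path_blocks_def using dec by blast
  qed
qed

lemma cycle_blocks_empty:
  assumes "S \<in> path_cycle_covers D"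
  shows "cycle_blocks D S = {}"
  using assms decomp_no_cycles by (fastforce simp: cycle_blocks_def path_cycle_covers_def)

end

section \<open>Signed expansion in power sums\<close>

lemma p_positive_power_sum: "l \<in> int_partitions \<Longrightarrow> p_positive (power_sum_sym l)"
  unfolding p_positive_def
  by (intro exI[of _ "Poly_Mapping.single l 1"])
    (auto simp: partition_comb_single lookup_single when_def)

lemma p_positive_sum:
  "(\<And>x. x \<in> A \<Longrightarrow> p_positive (f x)) \<Longrightarrow> p_positive (sum f A)"
proof (induction A rule: infinite_finite_induct)
  case (insert x A)
  then obtain c d where
    "Poly_Mapping.keys c \<subseteq> int_partitions" "\<And>l. 0 \<le> Poly_Mapping.lookup c l" "f x = partition_comb power_sum_sym c"
    "Poly_Mapping.keys d \<subseteq> int_partitions" "\<And>l. 0 \<le> Poly_Mapping.lookup d l" "sum f A = partition_comb power_sum_sym d"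
    unfolding p_positive_def by (metis insertCI)
  then show ?case
    unfolding p_positive_def using insert.hyps Poly_Mapping.keys_add[of c d]
    by (intro exI[of _ "c + d"]) (auto simp: partition_comb_add lookup_add)
qed (auto simp: p_positive_def partition_comb_def intro!: exI[of _ 0])

text \<open>A series without \<open>y\<close> has coefficient \<open>0\<close> at the other \<open>y\<close> monomials, and the involution fixes \<open>0\<close>.\<close>

lemma omega_x_const: "omega_x (const_mps f) = const_mps (omega f)"
  by (rule mps_eqI) (simp add: omega_x_def map_mps_def mcoeff_const omega_eqI)

lemma mcoeff_path_blocks:
  assumes D: "pair_fin_digraph D" "\<nexists>p. pre_digraph.cycle (with_proj D) p"
    and S: "S \<in> path_cycle_covers D"
  shows "mcoeff (aug_monomial_sym (block_sizes (path_blocks D S))) a =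
    of_nat (card {f \<in> colourings (pverts D) (\<lambda>_. 1) a.
      \<forall>u\<in>pverts D. \<forall>v\<in>pverts D. f u = f v \<longleftrightarrow> component S u = component S v})"
proof -
  interpret pair_fin_digraph D by fact
  let ?V = "pverts D" and ?w = "\<lambda>B. card {v \<in> pverts D. component S v = B}"
  have SV: "S \<subseteq> ?V \<times> ?V" using S in_arcsD1 in_arcsD2 by (auto simp: path_cycle_covers_def)
  have inside: "v \<in> ?V" if "(u, v) \<in> (S \<union> S\<inverse>)\<^sup>*" "u \<in> ?V" for u v
    using that by (induction rule: rtrancl_induct) (use SV in auto)
  have block: "{v \<in> ?V. component S v = component S u} = component S u" if "u \<in> ?V" for u
    using inside[OF _ that] sym_component_rel[of S]
    by (auto simp: component_eq_iff component_def dest: symD)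
  have "block_sizes (path_blocks D S) = image_mset ?w (mset_set (component S ` ?V))"
    unfolding block_sizes_def path_blocks_eq[OF D S]
    by (intro image_mset_cong) (auto simp: block pair_finite_verts)
  moreover have "?w B > 0" if "B \<in> component S ` ?V" for B
    using that pair_finite_verts by (auto simp: card_gt_0_iff)
  ultimately show ?thesis
    using pair_finite_verts unfolding card_colourings_with_kernel[OF pair_finite_verts]
    by (simp add: mcoeff_aug_monomial_sym)
qed

lemma int_card_filter: "finite A \<Longrightarrow> int (card {x \<in> A. P x}) = (\<Sum>x\<in>A. if P x then 1 else 0)"
  by (simp add: sum.If_cases Int_def)

lemma path_cycle_sym_acyclic:
  assumes D: "pair_fin_digraph D" "\<nexists>p. pre_digraph.cycle (with_proj D) p"
  shows "path_cycle_sym D =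
    const_mps (\<Sum>S\<in>path_cycle_covers D. aug_monomial_sym (block_sizes (path_blocks D S)))"
  unfolding path_cycle_sym_def const_mps_sum
  by (intro sum.cong refl) (simp add: cycle_blocks_empty[OF D] block_sizes_def power_sum_sym_def)

text \<open>Both sides are sums over colourings: on the left each \<open>f\<close> counts the covers whose paths
  are its colour classes, on the right the signs of those permutations in the range of summation that preserve it.\<close>

lemma path_covers_power_sum_expansion:
  fixes D :: "'v pair_pre_digraph"
  assumes D: "pair_fin_digraph D" "\<nexists>p. pre_digraph.cycle (with_proj D) p"
    and l: "\<And>\<sigma> a. \<sigma> permutes pverts D \<Longrightarrow> mcoeff (power_sum_sym (l \<sigma>) :: 'a::comm_ring_1 mps) a =
      of_nat (card {f \<in> colourings (pverts D) (\<lambda>_. 1) a. \<forall>v\<in>pverts D. f (\<sigma> v) = f v})"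
  shows "(\<Sum>S\<in>path_cycle_covers D. aug_monomial_sym (block_sizes (path_blocks D S))) =
    (\<Sum>\<sigma> | \<sigma> permutes pverts D \<and> (\<forall>v\<in>pverts D. (v, \<sigma> v) \<notin> parcs D).
      const_mps (of_int (sign \<sigma>)) * (power_sum_sym (l \<sigma>) :: 'a mps))"
proof (rule mps_eqI)
  interpret pair_fin_digraph D by fact
  fix a
  let ?V = "pverts D" and ?E = "parcs D" and ?C = "partial_injections (parcs D)"
  let ?F = "colourings ?V (\<lambda>_. 1) a"
  let ?A = "{\<sigma>. \<sigma> permutes ?V \<and> (\<forall>v\<in>?V. (v, \<sigma> v) \<notin> ?E)}"
  let ?K = "\<lambda>f S. \<forall>u\<in>?V. \<forall>v\<in>?V. f u = f v \<longleftrightarrow> component S u = component S v"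
  have E: "?E \<subseteq> ?V \<times> ?V" using in_arcsD1 in_arcsD2 by auto
  have fin: "finite ?F" "finite ?A" "finite ?C"
    using finite_colourings[OF pair_finite_verts] finite_permutations[OF pair_finite_verts] pair_finite_arcs
    by (auto simp: partial_injections_def)
  have "(\<Sum>S\<in>?C. int (card {f \<in> ?F. ?K f S})) = (\<Sum>f\<in>?F. int (card {S \<in> ?C. ?K f S}))"
    unfolding int_card_filter[OF fin(1)] int_card_filter[OF fin(3)] by (rule sum.swap)
  also have "\<dots> = (\<Sum>f\<in>?F. \<Sum>\<sigma>\<in>?A. if \<forall>v\<in>?V. f (\<sigma> v) = f v then sign \<sigma> else 0)"
  proof (intro sum.cong refl)
    fix f :: "'v \<Rightarrow> nat"
    show "int (card {S \<in> ?C. ?K f S}) = (\<Sum>\<sigma>\<in>?A. if \<forall>v\<in>?V. f (\<sigma> v) = f v then sign \<sigma> else 0)"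
      unfolding card_covers_with_kernel[OF pair_finite_verts E acyclic_parcs[OF D]]
        sum.inter_filter[OF fin(2), symmetric]
      by (rule sum.cong) auto
  qed
  also have "\<dots> = (\<Sum>\<sigma>\<in>?A. \<Sum>f\<in>?F. sign \<sigma> * (if \<forall>v\<in>?V. f (\<sigma> v) = f v then 1 else 0))"
    by (subst sum.swap) (intro sum.cong; simp)
  also have "\<dots> = (\<Sum>\<sigma>\<in>?A. sign \<sigma> * int (card {f \<in> ?F. \<forall>v\<in>?V. f (\<sigma> v) = f v}))"
    unfolding int_card_filter[OF fin(1)] sum_distrib_left ..
  finally have count: "(\<Sum>S\<in>?C. int (card {f \<in> ?F. ?K f S})) =
    (\<Sum>\<sigma>\<in>?A. sign \<sigma> * int (card {f \<in> ?F. \<forall>v\<in>?V. f (\<sigma> v) = f v}))" .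
  have "mcoeff (\<Sum>S\<in>path_cycle_covers D. aug_monomial_sym (block_sizes (path_blocks D S)) :: 'a mps) a =
      of_int (\<Sum>S\<in>?C. int (card {f \<in> ?F. ?K f S}))"
    using path_cycle_covers_eq[OF D] by (simp add: mcoeff_path_blocks[OF D])
  also have "\<dots> = mcoeff (\<Sum>\<sigma>\<in>?A. const_mps (of_int (sign \<sigma>)) * (power_sum_sym (l \<sigma>) :: 'a mps)) a"
    unfolding count mcoeff_sum mcoeff_const_mult of_int_sum by (rule sum.cong) (auto simp: l)
  finally show "mcoeff (\<Sum>S\<in>path_cycle_covers D. aug_monomial_sym (block_sizes (path_blocks D S)) :: 'a mps) a =
    mcoeff (\<Sum>\<sigma>\<in>?A. const_mps (of_int (sign \<sigma>)) * (power_sum_sym (l \<sigma>) :: 'a mps)) a" .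
qed

theorem proposition7:
  fixes D :: "'v pair_pre_digraph"
  assumes "pair_fin_digraph D"
    and "\<nexists>p. pre_digraph.cycle (with_proj D) p"
  shows "\<exists>f. omega_x (path_cycle_sym D) = const_mps f \<and> p_positive f"
proof -
  interpret pair_fin_digraph D by fact
  let ?V = "pverts D"
  let ?A = "{\<sigma>. \<sigma> permutes ?V \<and> (\<forall>v\<in>?V. (v, \<sigma> v) \<notin> parcs D)}"
  have "\<forall>\<sigma>\<in>{\<sigma>. \<sigma> permutes ?V}. \<exists>l. l \<in> int_partitions \<and>
      (\<forall>a. mcoeff (power_sum_sym l :: rat mps) a =
        of_nat (card {f \<in> colourings ?V (\<lambda>_. 1) a. \<forall>v\<in>?V. f (\<sigma> v) = f v})) \<and>
      (\<Prod>k\<in>#l. (-1) ^ (k - 1)) = sign \<sigma>"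
    (is "\<forall>\<sigma>\<in>_. \<exists>l. ?P \<sigma> l")
  proof
    fix \<sigma> assume "\<sigma> \<in> {\<sigma>. \<sigma> permutes ?V}"
    then show "\<exists>l. ?P \<sigma> l"
      using power_sum_sym_of_permutation[OF pair_finite_verts, of "\<lambda>_. 1" \<sigma>, where ?'a = rat]
      by (simp add: Bex_def)
  qed
  from bchoice[OF this] obtain l where "\<forall>\<sigma>\<in>{\<sigma>. \<sigma> permutes ?V}. ?P \<sigma> (l \<sigma>)"
    by (elim exE) (rule that)
  then have l: "\<And>\<sigma>. \<sigma> permutes ?V \<Longrightarrow> l \<sigma> \<in> int_partitions"
    "\<And>\<sigma> a. \<sigma> permutes ?V \<Longrightarrow> mcoeff (power_sum_sym (l \<sigma>) :: rat mps) a =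
      of_nat (card {f \<in> colourings ?V (\<lambda>_. 1) a. \<forall>v\<in>?V. f (\<sigma> v) = f v})"
    "\<And>\<sigma>. \<sigma> permutes ?V \<Longrightarrow> (\<Prod>k\<in>#l \<sigma>. (-1) ^ (k - 1)) = sign \<sigma>"
    by simp_all
  let ?g = "\<Sum>\<sigma>\<in>?A. power_sum_sym (l \<sigma>) :: rat mps"
  have "omega_pair (const_mps (of_int (sign \<sigma>)) * power_sum_sym (l \<sigma>)) (power_sum_sym (l \<sigma>) :: rat mps)"
    if "\<sigma> \<in> ?A" for \<sigma>
    using omega_pair_power_sum[of "l \<sigma>", where ?'a = rat] l[of \<sigma>] that by simp
  then have "omega_pair (\<Sum>\<sigma>\<in>?A. const_mps (of_int (sign \<sigma>)) * power_sum_sym (l \<sigma>)) ?g"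
    by (rule omega_pair_sum)
  moreover have "(\<Sum>S\<in>path_cycle_covers D. aug_monomial_sym (block_sizes (path_blocks D S))) =
      (\<Sum>\<sigma>\<in>?A. const_mps (of_int (sign \<sigma>)) * (power_sum_sym (l \<sigma>) :: rat mps))"
    by (rule path_covers_power_sum_expansion[OF assms]) (rule l(2))
  ultimately have "omega_x (path_cycle_sym D) = const_mps ?g"
    unfolding path_cycle_sym_acyclic[OF assms] omega_x_const by (simp only: omega_eqI)
  moreover have "p_positive ?g"
    using l(1) by (intro p_positive_sum p_positive_power_sum) auto
  ultimately show ?thesis by blast
qed

end
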